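(* Let $A(1)$ be the subalgebra of the mod $2$ Steenrod algebra generated by $\mathrm{Sq}^1$ and $\mathrm{Sq}^2$, and let $HH_n(A(1),A(1))$ denote its $n$-th Hochschild homology over $\mathbb{F}_2$. Then for every $n\geq 0$, \[ \dim_{\mathbb{F}_2} HH_n(A(1),A(1)) = \begin{cases} 2n+5 & \text{if } 2\mid n,\\ 2n+6 & \text{if } n\equiv 1 \pmod 4,\\ 2n+4 & \text{if } n\equiv 3 \pmod 4.\end{cases}\] Equivalently, the Poincaré series $\sum_n \dim_{\mathbb{F}_2} HH_n(A(1),A(1))\, s^n$ equals \[ \frac{5+8s+9s^2+10s^3+\frac{8s^4}{1-s}}{1-s^4}. \] Moreover, keeping track also of the internal (topological) grading, the Poincaré series $\sum_{n,m}\dim_{\mathbb{F}_2} HH_{n,m}(A(1),A(1))\, s^n u^m$ of the bigraded vector space $HH_{*,*}(A(1),A(1))$ equals \[ \Big( (1+u)\Big(1+u^2 + su(1+u^2+u^5) + s^2u^2(1+2u^5+u^7) + s^3u^3(1+u^4+u^5+u^6+u^9) + \tfrac{s^4u^4(1+u^4+u^5+u^9)}{1-su}\Big) + u^6+su^2+su^8+s^2u^4\Big)\frac{1}{1-s^4u^{12}}, \] where $s$ indexes homological degree and $u$ indexes topological degree.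
   Context: $A(1)$ is the $8$-dimensional graded $\mathbb{F}_2$-algebra generated by $\mathrm{Sq}^1$ (degree $1$) and $\mathrm{Sq}^2$ (degree $2$) subject to the Adem relations $\mathrm{Sq}^1\mathrm{Sq}^1=0$, $\mathrm{Sq}^2\mathrm{Sq}^2=\mathrm{Sq}^1\mathrm{Sq}^2\mathrm{Sq}^1$ (which imply $\mathrm{Sq}^1\mathrm{Sq}^2\mathrm{Sq}^1\mathrm{Sq}^2=\mathrm{Sq}^2\mathrm{Sq}^1\mathrm{Sq}^2\mathrm{Sq}^1$). Hochschild homology $HH_*(A,A)$ of an algebra $A$ over a field $k$ is the homology of the standard Hochschild chain complex $C_n = A^{\otimes_k (n+1)}$ with differential $b(a_0\otimes\cdots\otimes a_n)=\sum_{i=0}^{n-1}(-1)^i a_0\otimes\cdots\otimes a_ia_{i+1}\otimes\cdots\otimes a_n + (-1)^n a_na_0\otimes a_1\otimes\cdots\otimes a_{n-1}$. When $A$ is graded, the chain complex, hence $HH_n$, inherits an internal grading (the sum of the degrees of the tensor factors), giving the bigraded groups $HH_{n,m}$ with $n$ the homological and $m$ the internal (topological) degree. *)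

theory Defs
  imports Main "HOL-Library.Z2" "HOL-Library.Function_Algebras" "HOL-Computational_Algebra.Formal_Power_Series"
begin

text \<open>Generators Sq1 (degree 1) and Sq2 (degree 2).  Monomials are words in the
generators.  The relations Sq1 Sq1 = 0, Sq2 Sq2 = Sq1 Sq2 Sq1 (and their consequence
Sq2 Sq1 Sq2 Sq1 = Sq1 Sq2 Sq1 Sq2) give the normal-form words
[], Sq1, Sq2, Sq1Sq2, Sq2Sq1, Sq1Sq2Sq1, Sq2Sq1Sq2, Sq1Sq2Sq1Sq2, which form an
F_2-basis of A(1).  Every product of basis monomials is a basis monomial or zero
(None).\<close>

datatype gen = Sq1 | Sq2

type_synonym word = "gen list"

definition A1_basis :: "word set" where
  "A1_basis = {[], [Sq1], [Sq2], [Sq1,Sq2], [Sq2,Sq1], [Sq1,Sq2,Sq1], [Sq2,Sq1,Sq2],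
               [Sq1,Sq2,Sq1,Sq2]}"

fun gen_deg :: "gen \<Rightarrow> nat" where
  "gen_deg Sq1 = 1"
| "gen_deg Sq2 = 2"

definition word_deg :: "word \<Rightarrow> nat" where
  "word_deg w = (\<Sum>g\<leftarrow>w. gen_deg g)"

text \<open>Right multiplication of a normal-form monomial by a generator, reduced with the
Adem relations.\<close>

fun rmul :: "word \<Rightarrow> gen \<Rightarrow> word option" where
  "rmul [] g = Some [g]"
| "rmul [Sq1] Sq1 = None"
| "rmul [Sq1] Sq2 = Some [Sq1,Sq2]"
| "rmul [Sq2] Sq1 = Some [Sq2,Sq1]"
| "rmul [Sq2] Sq2 = Some [Sq1,Sq2,Sq1]"
| "rmul [Sq1,Sq2] Sq1 = Some [Sq1,Sq2,Sq1]"
| "rmul [Sq1,Sq2] Sq2 = None"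
| "rmul [Sq2,Sq1] Sq1 = None"
| "rmul [Sq2,Sq1] Sq2 = Some [Sq2,Sq1,Sq2]"
| "rmul [Sq1,Sq2,Sq1] Sq1 = None"
| "rmul [Sq1,Sq2,Sq1] Sq2 = Some [Sq1,Sq2,Sq1,Sq2]"
| "rmul [Sq2,Sq1,Sq2] Sq1 = Some [Sq1,Sq2,Sq1,Sq2]"
| "rmul [Sq2,Sq1,Sq2] Sq2 = None"
| "rmul [Sq1,Sq2,Sq1,Sq2] g = None"
| "rmul w g = None"

fun mult :: "word \<Rightarrow> word \<Rightarrow> word option" where
  "mult x [] = Some x"
| "mult x (g # v) = (case rmul x g of None \<Rightarrow> None | Some y \<Rightarrow> mult y v)"

text \<open>A chain is an F_2-linear combination of basis tensors a_0 \<otimes> ... \<otimes> a_n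
(lists of basis monomials), i.e. a function from lists of words to F_2.\<close>

type_synonym chain = "word list \<Rightarrow> bit"

definition chscale :: "bit \<Rightarrow> chain \<Rightarrow> chain" where
  "chscale c f = (\<lambda>t. c * f t)"

definition tuples :: "nat \<Rightarrow> word list set" where
  "tuples n = {t. length t = n + 1 \<and> set t \<subseteq> A1_basis}"

definition tuple_deg :: "word list \<Rightarrow> nat" where
  "tuple_deg t = (\<Sum>w\<leftarrow>t. word_deg w)"

definition chains :: "nat \<Rightarrow> chain set" where
  "chains n = {f. \<forall>t. f t \<noteq> 0 \<longrightarrow> t \<in> tuples n}"

definition chains_deg :: "nat \<Rightarrow> nat \<Rightarrow> chain set" where
  "chains_deg n m = {f \<in> chains n. \<forall>t. f t \<noteq> 0 \<longrightarrow> tuple_deg t = m}"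

definition basis_vec :: "word list \<Rightarrow> chain" where
  "basis_vec t = (\<lambda>s. if s = t then 1 else 0)"

definition opt_vec :: "word list option \<Rightarrow> chain" where
  "opt_vec ot = (case ot of None \<Rightarrow> (\<lambda>_. 0) | Some s \<Rightarrow> basis_vec s)"

definition face :: "nat \<Rightarrow> word list \<Rightarrow> chain" where
  "face i t = opt_vec (map_option (\<lambda>c. take i t @ c # drop (i + 2) t) (mult (t ! i) (t ! (i + 1))))"

definition last_face :: "nat \<Rightarrow> word list \<Rightarrow> chain" where
  "last_face n t = opt_vec (map_option (\<lambda>c. c # take (n - 1) (drop 1 t)) (mult (t ! n) (t ! 0)))"

definition hb_basis :: "nat \<Rightarrow> word list \<Rightarrow> chain" where
  "hb_basis n t = (\<lambda>s. (\<Sum>i<n. (-1) ^ i * face i t s) + (-1) ^ n * last_face n t s)"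

definition hoch_b :: "nat \<Rightarrow> chain \<Rightarrow> chain" where
  "hoch_b n f = (\<lambda>s. \<Sum>t\<in>tuples n. f t * hb_basis n t s)"

text \<open>Cycles (kernel of b_n; b_0 = 0 since C_{-1} = 0) and boundaries (image of
b_{n+1}), in bidegree (n,m).\<close>

definition cycles :: "nat \<Rightarrow> nat \<Rightarrow> chain set" where
  "cycles n m = (if n = 0 then chains_deg 0 m else {f \<in> chains_deg n m. hoch_b n f = (\<lambda>_. 0)})"

definition boundaries :: "nat \<Rightarrow> nat \<Rightarrow> chain set" where
  "boundaries n m = hoch_b (Suc n) ` chains_deg (Suc n) m"

definition cycles_all :: "nat \<Rightarrow> chain set" where
  "cycles_all n = (if n = 0 then chains 0 else {f \<in> chains n. hoch_b n f = (\<lambda>_. 0)})"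

definition boundaries_all :: "nat \<Rightarrow> chain set" where
  "boundaries_all n = hoch_b (Suc n) ` chains (Suc n)"

definition HH_dim :: "nat \<Rightarrow> nat" where
  "HH_dim n = vector_space.dim chscale (cycles_all n) - vector_space.dim chscale (boundaries_all n)"

definition HH_bidim :: "nat \<Rightarrow> nat \<Rightarrow> nat" where
  "HH_bidim n m = vector_space.dim chscale (cycles n m) - vector_space.dim chscale (boundaries n m)"

text \<open>Poincare series.  One variable: a rat fps in s.  Two variables: a rat fps fps,
where the outer index is the homological degree n (variable s) and the inner index the
internal degree m (variable u), i.e. (P $ n) $ m = dim HH_{n,m}.\<close>

definition HH_poincare :: "rat fps" where
  "HH_poincare = Abs_fps (\<lambda>n. of_nat (HH_dim n))"

definition HH_bipoincare :: "rat fps fps" where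
  "HH_bipoincare = Abs_fps (\<lambda>n. Abs_fps (\<lambda>m. of_nat (HH_bidim n m)))"

end

theory Submission
  imports Defs "HOL-Library.Poly_Mapping" "HOL-Library.Product_Lexorder"
begin

text \<open>
  Since \<open>A(1)\<close> is a cocommutative Hopf algebra, the minimal resolution of the trivial module induces
  a minimal free bimodule resolution \<open>P\<close> of \<open>A(1)\<close>. The Hochschild complex with coefficients in \<open>P\<close>
  is a double complex that projects both to the Hochschild complex and to the small complex
  \<open>P \<otimes> A(1)\<close> over the enveloping algebra. Both projections are quasi-isomorphisms: in one
  direction by the contraction of the bar construction, in the other by a discrete Morse matching on
  the resolution. In the small complex only commutators with \<open>Sq1\<close> and the adjoint action of \<open>Sq2\<close>
  survive, so it is a direct sum of copies, shifted by powers of the periodicity class of bidegree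
  \<open>(4, 12)\<close>, of one explicit complex whose homology is read off. Over the two-element field
  dimensions are compared by counting elements.
\<close>

section \<open>The algebra\<close>

text \<open>An explicit chain map between the bar complex and the minimal resolution would be
  unwieldy, so none is written down. Instead both projections are coned off at once:
  \<open>D\<close> is the differential of the cone, and the Hochschild cells \<open>H k\<close> and
  the small cells \<open>L x [w]\<close> span two subcomplexes of it. Dividing by one of them leaves
  the cone of the projection to the other, so a projection is a quasi-isomorphism exactly when the
  inclusion of the opposite subcomplex is one. It is enough to give, on each quotient, a homotopy
  that is right up to smaller terms; for the resolution this becomes a finite check over the
  generators and the eight monomials. No quotient space is formed: all spaces of chains in a fixed
  degree are finite, so equality of homology is an identity between products of cardinalities, and
  dimensions are recovered as exponents of 2.\<close>

text \<open>
  \<open>Nul\<close> is the zero of \<open>A(1)\<close>; with it the basis monomials are closed under multiplication.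
\<close>

datatype mon = Nul | One | Ma | Mb | Mab | Mba | Maba | Mbab | Mabab

fun mon_a :: "mon \<Rightarrow> mon" where
  "mon_a One = Ma" | "mon_a Mb = Mba" | "mon_a Mab = Maba" | "mon_a Mbab = Mabab" | "mon_a _ = Nul"

fun mon_b :: "mon \<Rightarrow> mon" where
  "mon_b One = Mb" | "mon_b Ma = Mab" | "mon_b Mb = Maba" | "mon_b Mba = Mbab"
| "mon_b Maba = Mabab" | "mon_b _ = Nul"

instantiation mon :: semigroup_mult
begin

fun times_mon :: "mon \<Rightarrow> mon \<Rightarrow> mon" where
  "x * Nul = Nul"
| "x * One = x"
| "x * Ma = mon_a x"
| "x * Mb = mon_b x"
| "x * Mab = mon_b (mon_a x)"
| "x * Mba = mon_a (mon_b x)"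
| "x * Maba = mon_a (mon_b (mon_a x))"
| "x * Mbab = mon_b (mon_a (mon_b x))"
| "x * Mabab = mon_b (mon_a (mon_b (mon_a x)))"

instance
proof
  fix x y z :: mon
  show "x * y * z = x * (y * z)"
    by (cases x; cases y; cases z; simp)
qed

end

lemma One_mult [simp]: "One * x = x"
  by (cases x) auto

lemma Nul_mult [simp]: "Nul * x = Nul"
  by (cases x) auto

fun mon_deg :: "mon \<Rightarrow> nat" where
  "mon_deg Nul = 0" | "mon_deg One = 0" | "mon_deg Ma = 1" | "mon_deg Mb = 2" | "mon_deg Mab = 3"
| "mon_deg Mba = 3" | "mon_deg Maba = 4" | "mon_deg Mbab = 5" | "mon_deg Mabab = 6"

lemma mon_deg_mult: "x * y \<noteq> Nul \<Longrightarrow> mon_deg (x * y) = mon_deg x + mon_deg y"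
  by (cases x; cases y; simp)

lemma UNIV_mon: "(UNIV :: mon set) = {Nul, One, Ma, Mb, Mab, Mba, Maba, Mbab, Mabab}"
  using mon.exhaust by blast

instance mon :: finite
  by standard (simp add: UNIV_mon)

section \<open>Cells and chains\<close>

text \<open>
  The generators of the minimal bimodule resolution are dual to the basis \<open>h\<^sub>0\<^sup>i b\<^sup>j\<close>,
  \<open>h\<^sub>1 b\<^sup>j\<close>, \<open>h\<^sub>1\<^sup>2 b\<^sup>j\<close>, \<open>a h\<^sub>0\<^sup>i b\<^sup>j\<close> of the cohomology of \<open>A(1)\<close>.
\<close>

datatype rgen = X nat nat | Y1 nat | Y2 nat | Z nat nat

fun rgen_hdeg :: "rgen \<Rightarrow> nat" where
  "rgen_hdeg (X i j) = i + 4 * j"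
| "rgen_hdeg (Y1 j) = 1 + 4 * j"
| "rgen_hdeg (Y2 j) = 2 + 4 * j"
| "rgen_hdeg (Z i j) = 3 + i + 4 * j"

fun rgen_ideg :: "rgen \<Rightarrow> nat" where
  "rgen_ideg (X i j) = i + 12 * j"
| "rgen_ideg (Y1 j) = 2 + 12 * j"
| "rgen_ideg (Y2 j) = 4 + 12 * j"
| "rgen_ideg (Z i j) = 7 + i + 12 * j"

text \<open>
  \<open>H [a\<^sub>1, \<dots>, a\<^sub>q, a\<^sub>0]\<close> stands for the Hochschild chain \<open>a\<^sub>0 \<otimes> a\<^sub>1 \<otimes> \<dots> \<otimes> a\<^sub>q\<close>,
  \<open>L x [w', a\<^sub>1, \<dots>, a\<^sub>q, w]\<close> for \<open>w x w' \<otimes> a\<^sub>1 \<otimes> \<dots> \<otimes> a\<^sub>q\<close> in the Hochschild complex with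
  coefficients in the resolution, and \<open>L x [w]\<close> for \<open>w x\<close> in the small complex obtained by
  tensoring the resolution with \<open>A(1)\<close> over the enveloping algebra. Cells that contain \<open>Nul\<close> are zero.
  Homological degrees of cells are those of the mapping cone, so that \<open>HH\<^sub>n\<close> sits in degree \<open>n + 1\<close>.
\<close>

datatype cell = L rgen "mon list" | H "mon list"

fun good :: "cell \<Rightarrow> bool" where
  "good (L x l) \<longleftrightarrow> l \<noteq> [] \<and> Nul \<notin> set l"
| "good (H l) \<longleftrightarrow> l \<noteq> [] \<and> Nul \<notin> set l"

fun hdeg :: "cell \<Rightarrow> nat" where
  "hdeg (L x l) = rgen_hdeg x + length l"
| "hdeg (H l) = length l"

definition list_deg :: "mon list \<Rightarrow> nat" where
  "list_deg l = (\<Sum>w\<leftarrow>l. mon_deg w)"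

fun ideg :: "cell \<Rightarrow> nat" where
  "ideg (L x l) = rgen_ideg x + list_deg l"
| "ideg (H l) = list_deg l"

abbreviation keys :: "('a \<Rightarrow>\<^sub>0 'b::zero) \<Rightarrow> 'a set" where
  "keys \<equiv> Poly_Mapping.keys"

abbreviation lookup :: "('a \<Rightarrow>\<^sub>0 'b::zero) \<Rightarrow> 'a \<Rightarrow> 'b" where
  "lookup \<equiv> Poly_Mapping.lookup"

type_synonym vec = "cell \<Rightarrow>\<^sub>0 bit"

definition bas :: "cell \<Rightarrow> vec" where
  "bas c = (if good c then Poly_Mapping.single c 1 else 0)"

definition lsum :: "cell list \<Rightarrow> vec" where
  "lsum cs = (\<Sum>c\<leftarrow>cs. bas c)"

definition lin :: "(cell \<Rightarrow> cell list) \<Rightarrow> vec \<Rightarrow> vec" where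
  "lin f v = (\<Sum>c\<in>keys v. lsum (f c))"

lemma vec_add_self [simp]: "(v :: vec) + v = 0"
  by (rule poly_mapping_eqI) (simp add: lookup_add)

lemma vec_add_self_left [simp]: "(v :: vec) + (v + w) = w"
  by (simp add: add.assoc [symmetric])

lemma vec_eq_iff_add: "(v :: vec) = w \<longleftrightarrow> v + w = 0"
  by (metis vec_add_self vec_add_self_left add.right_neutral)

lemma lsum_simps [simp]:
  "lsum [] = 0" "lsum (c # cs) = bas c + lsum cs" "lsum (cs @ ds) = lsum cs + lsum ds"
  by (simp_all add: lsum_def)

lemma keys_lsum: "keys (lsum cs) \<subseteq> {c \<in> set cs. good c}"
proof (induction cs)
  case (Cons c cs)
  have "keys (bas c) \<subseteq> {d \<in> set (c # cs). good d}"
    by (simp add: bas_def)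
  with Cons show ?case
    using Poly_Mapping.keys_add [of "bas c" "lsum cs"] by auto
qed simp

lemma lin_superset:
  assumes "finite A" "keys v \<subseteq> A"
  shows "lin f v = (\<Sum>c\<in>A. if lookup v c = 1 then lsum (f c) else 0)"
proof -
  have "lin f v = (\<Sum>c\<in>keys v. if lookup v c = 1 then lsum (f c) else 0)"
    unfolding lin_def by (intro sum.cong) (auto simp: in_keys_iff)
  also have "\<dots> = (\<Sum>c\<in>A. if lookup v c = 1 then lsum (f c) else 0)"
    using assms by (intro sum.mono_neutral_left) (auto simp: in_keys_iff)
  finally show ?thesis .
qed

lemma lin_add [simp]: "lin f (u + v) = lin f u + lin f v"
proof -
  let ?A = "keys u \<union> keys v"
  have "lin f (u + v) = (\<Sum>c\<in>?A. if lookup (u + v) c = 1 then lsum (f c) else 0)"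
    using Poly_Mapping.keys_add [of u v] by (intro lin_superset) auto
  also have "\<dots> = (\<Sum>c\<in>?A. (if lookup u c = 1 then lsum (f c) else 0) +
                            (if lookup v c = 1 then lsum (f c) else 0))"
    by (intro sum.cong) (auto simp: lookup_add)
  also have "\<dots> = lin f u + lin f v"
    by (simp add: sum.distrib lin_superset [symmetric])
  finally show ?thesis .
qed

lemma lin_0 [simp]: "lin f 0 = 0"
  by (simp add: lin_def)

lemma lin_sum: "lin f (sum g I) = (\<Sum>i\<in>I. lin f (g i))"
  by (induction I rule: infinite_finite_induct) auto

lemma lin_bas: "good c \<Longrightarrow> lin f (bas c) = lsum (f c)"
  by (simp add: lin_def bas_def)

text \<open>Says that \<open>f\<close> respects the identification of zero cells with 0; this makes
  \<open>lin f\<close> computable term by term on \<open>lsum cs\<close>, where zero cells have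
  already disappeared.\<close>

definition kills_bad :: "(cell \<Rightarrow> cell list) \<Rightarrow> bool" where
  "kills_bad f \<longleftrightarrow> (\<forall>c. \<not> good c \<longrightarrow> lsum (f c) = 0)"

lemma lin_bas': "kills_bad f \<Longrightarrow> lin f (bas c) = lsum (f c)"
  by (cases "good c") (auto simp: lin_bas kills_bad_def, simp add: bas_def)

lemma lin_lsum:
  assumes "kills_bad f"
  shows "lin f (lsum cs) = (\<Sum>c\<leftarrow>cs. lsum (f c))"
  using assms by (induction cs) (auto simp: lin_bas')

lemma lsum_eq_0: "(\<And>c. c \<in> set cs \<Longrightarrow> \<not> good c) \<Longrightarrow> lsum cs = 0"
  by (induction cs) (auto simp: bas_def)

definition goodvec :: "vec \<Rightarrow> bool" where
  "goodvec v \<longleftrightarrow> (\<forall>c\<in>keys v. good c)"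

lemma goodvec_decomp:
  assumes "goodvec v"
  shows "v = (\<Sum>c\<in>keys v. bas c)"
proof (rule poly_mapping_eqI)
  fix d
  have "lookup (\<Sum>c\<in>keys v. bas c) d = (\<Sum>c\<in>keys v. lookup (bas c) d)"
    by (simp add: lookup_sum)
  also have "\<dots> = (\<Sum>c\<in>keys v. if c = d then 1 else 0)"
    using assms by (intro sum.cong) (auto simp: bas_def goodvec_def lookup_single when_def)
  also have "\<dots> = lookup v d"
    by (auto simp: in_keys_iff)
  finally show "lookup v d = lookup (\<Sum>c\<in>keys v. bas c) d" by simp
qed

lemma keys_lin: "keys (lin f v) \<subseteq> (\<Union>c\<in>keys v. {d \<in> set (f c). good d})"
proof -
  have "keys (lin f v) \<subseteq> (\<Union>c\<in>keys v. keys (lsum (f c)))"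
    unfolding lin_def by (rule keys_sum)
  also have "\<dots> \<subseteq> (\<Union>c\<in>keys v. {d \<in> set (f c). good d})"
    using keys_lsum by blast
  finally show ?thesis .
qed

lemma lin_comp_eq:
  assumes "kills_bad g" "goodvec v"
    and "\<And>c. c \<in> keys v \<Longrightarrow> (\<Sum>d\<leftarrow>f c. lsum (g d)) = lsum (h c)"
  shows "lin g (lin f v) = lin h v"
  using assms by (simp add: lin_def [of f] lin_def [of h] lin_sum lin_lsum)

section \<open>Relative acyclicity and cardinalities\<close>

lemma card_eq_sum_fibers:
  assumes "finite A"
  shows "card A = (\<Sum>z\<in>f ` A. card {x \<in> A. f x = z})"
  using sum.image_gen [OF assms, of "\<lambda>_. 1 :: nat" f] by simp

text \<open>The fibre of addition over \<open>a + b\<close> consists of the pairs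
  \<open>(a + x, b + x)\<close> with \<open>x\<close> in \<open>A \<inter> B\<close>, by
  characteristic 2.\<close>

lemma card_sum_of_subgroups:
  fixes A B :: "vec set"
  assumes fin: "finite A" "finite B"
    and A: "0 \<in> A" "\<And>x y. x \<in> A \<Longrightarrow> y \<in> A \<Longrightarrow> x + y \<in> A"
    and B: "0 \<in> B" "\<And>x y. x \<in> B \<Longrightarrow> y \<in> B \<Longrightarrow> x + y \<in> B"
  shows "card A * card B = card ((\<lambda>(x, y). x + y) ` (A \<times> B)) * card (A \<inter> B)"
proof -
  let ?f = "\<lambda>(x, y). x + y :: vec"
  have "card {p \<in> A \<times> B. ?f p = z} = card (A \<inter> B)" if "z \<in> ?f ` (A \<times> B)" for z
  proof -
    from that obtain a b where ab: "a \<in> A" "b \<in> B" "z = a + b" by auto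
    have "bij_betw (\<lambda>x. (a + x, b + x)) (A \<inter> B) {p \<in> A \<times> B. ?f p = z}"
    proof (rule bij_betwI [where g = "\<lambda>p. a + fst p"])
      show "(\<lambda>x. (a + x, b + x)) \<in> A \<inter> B \<rightarrow> {p \<in> A \<times> B. ?f p = z}"
        using ab A B by (auto simp: ac_simps)
      show "(\<lambda>p. a + fst p) \<in> {p \<in> A \<times> B. ?f p = z} \<rightarrow> A \<inter> B"
      proof
        fix p assume p: "p \<in> {p \<in> A \<times> B. ?f p = z}"
        then have "a + fst p = b + snd p"
          using ab by (cases p) (metis (mono_tags, lifting) add.commute add.left_commute case_prod_conv
              fst_conv mem_Collect_eq snd_conv vec_add_self_left)
        moreover have "a + fst p \<in> A" "b + snd p \<in> B" using p ab A B by auto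
        ultimately show "a + fst p \<in> A \<inter> B" by simp
      qed
      show "a + fst (a + x, b + x) = x" for x by simp
      show "(a + (a + fst p), b + (a + fst p)) = p" if "p \<in> {p \<in> A \<times> B. ?f p = z}" for p
        using that ab by (cases p) (auto, metis add.commute add.left_commute vec_add_self_left)
    qed
    then show ?thesis by (rule bij_betw_same_card [symmetric])
  qed
  moreover have "card (A \<times> B) = (\<Sum>z\<in>?f ` (A \<times> B). card {p \<in> A \<times> B. ?f p = z})"
    using fin by (intro card_eq_sum_fibers) simp
  ultimately show ?thesis by (simp add: card_cartesian_product)
qed

lemma card_hom:
  fixes G :: "vec set" and f :: "vec \<Rightarrow> vec"
  assumes fin: "finite G" and G: "0 \<in> G" "\<And>x y. x \<in> G \<Longrightarrow> y \<in> G \<Longrightarrow> x + y \<in> G"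
    and f: "\<And>x y. f (x + y) = f x + f y"
  shows "card G = card (f ` G) * card {x \<in> G. f x = 0}"
proof -
  have "card {x \<in> G. f x = z} = card {x \<in> G. f x = 0}" if "z \<in> f ` G" for z
  proof -
    from that obtain a where a: "a \<in> G" "z = f a" by auto
    have "bij_betw (\<lambda>x. a + x) {x \<in> G. f x = 0} {x \<in> G. f x = z}"
      by (rule bij_betwI [where g = "\<lambda>x. a + x"]) (use a G f in auto)
    then show ?thesis by (rule bij_betw_same_card [symmetric])
  qed
  moreover have "card G = (\<Sum>z\<in>f ` G. card {x \<in> G. f x = z})"
    using fin by (intro card_eq_sum_fibers)
  ultimately show ?thesis by simp
qed

text \<open>\<open>Q\<close> cuts out a subcomplex. The set \<open>M\<close> of internal degrees
  serves both gradings: \<open>UNIV\<close> gives the total dimension, \<open>{m}\<close> the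
  bigraded one.\<close>

definition chn :: "(cell \<Rightarrow> bool) \<Rightarrow> nat set \<Rightarrow> nat \<Rightarrow> vec set" where
  "chn Q M n = {v. \<forall>c\<in>keys v. good c \<and> Q c \<and> hdeg c = n \<and> ideg c \<in> M}"

definition cyc :: "(cell \<Rightarrow> cell list) \<Rightarrow> (cell \<Rightarrow> bool) \<Rightarrow> nat set \<Rightarrow> nat \<Rightarrow> vec set" where
  "cyc D Q M n = {v \<in> chn Q M n. lin D v = 0}"

definition bdr :: "(cell \<Rightarrow> cell list) \<Rightarrow> (cell \<Rightarrow> bool) \<Rightarrow> nat set \<Rightarrow> nat \<Rightarrow> vec set" where
  "bdr D Q M n = lin D ` chn Q M (Suc n)"

lemma chn_0 [simp]: "0 \<in> chn Q M n"
  by (simp add: chn_def)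

lemma chn_add: "u \<in> chn Q M n \<Longrightarrow> v \<in> chn Q M n \<Longrightarrow> u + v \<in> chn Q M n"
  using Poly_Mapping.keys_add [of u v] unfolding chn_def by blast

lemma chn_mono: "(\<And>c. Q c \<Longrightarrow> R c) \<Longrightarrow> chn Q M n \<subseteq> chn R M n"
  unfolding chn_def by blast

lemma goodvec_chn: "v \<in> chn Q M n \<Longrightarrow> goodvec v"
  by (auto simp: chn_def goodvec_def)

lemma chn_linI:
  assumes "v \<in> chn R M n"
    and "\<And>c d. good c \<Longrightarrow> R c \<Longrightarrow> hdeg c = n \<Longrightarrow> d \<in> set (f c) \<Longrightarrow> good d \<Longrightarrow>
      Q d \<and> hdeg d = n' \<and> ideg d = ideg c"
  shows "lin f v \<in> chn Q M n'"
  unfolding chn_def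
proof (intro CollectI ballI)
  fix d assume "d \<in> keys (lin f v)"
  then obtain c where "c \<in> keys v" "d \<in> set (f c)" "good d" using keys_lin by blast
  moreover from this assms(1) have "good c" "R c" "hdeg c = n" "ideg c \<in> M" by (auto simp: chn_def)
  ultimately show "good d \<and> Q d \<and> hdeg d = n' \<and> ideg d \<in> M" using assms(2) by metis
qed

lemma finite_rgen_hdeg: "finite {x. rgen_hdeg x \<le> n}"
proof (rule finite_subset)
  show "{x. rgen_hdeg x \<le> n} \<subseteq> (\<lambda>(i, j). X i j) ` ({..n} \<times> {..n}) \<union> Y1 ` {..n} \<union> Y2 ` {..n}
          \<union> (\<lambda>(i, j). Z i j) ` ({..n} \<times> {..n})"
  proof
    fix x assume "x \<in> {x. rgen_hdeg x \<le> n}"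
    then show "x \<in> (\<lambda>(i, j). X i j) ` ({..n} \<times> {..n}) \<union> Y1 ` {..n} \<union> Y2 ` {..n}
          \<union> (\<lambda>(i, j). Z i j) ` ({..n} \<times> {..n})"
      by (cases x) (auto simp: image_iff)
  qed
qed auto

lemma finite_cells: "finite {c. hdeg c = n}"
proof (rule finite_subset)
  let ?l = "{l :: mon list. set l \<subseteq> UNIV \<and> length l \<le> n}"
  show "{c. hdeg c = n} \<subseteq> (\<lambda>(x, l). L x l) ` ({x. rgen_hdeg x \<le> n} \<times> ?l) \<union> H ` ?l"
  proof
    fix c assume "c \<in> {c. hdeg c = n}"
    then show "c \<in> (\<lambda>(x, l). L x l) ` ({x. rgen_hdeg x \<le> n} \<times> ?l) \<union> H ` ?l"
      by (cases c) auto
  qed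
  have "finite ?l" by (rule finite_lists_length_le) simp
  then show "finite ((\<lambda>(x, l). L x l) ` ({x. rgen_hdeg x \<le> n} \<times> ?l) \<union> H ` ?l)"
    using finite_rgen_hdeg by blast
qed

lemma vec_eqI_keys: "keys u = keys v \<Longrightarrow> u = (v :: vec)"
  by (rule poly_mapping_eqI) (metis bit_not_one_iff in_keys_iff)

lemma finite_chn: "finite (chn Q M n)"
proof (rule finite_imageD)
  show "finite (keys ` chn Q M n)"
    by (rule finite_subset [of _ "Pow {c. hdeg c = n}"]) (auto simp: chn_def finite_cells)
  show "inj_on keys (chn Q M n)"
    by (rule inj_onI) (rule vec_eqI_keys)
qed

lemma card_chn: "card (chn Q M n) = 2 ^ card {c. good c \<and> Q c \<and> hdeg c = n \<and> ideg c \<in> M}"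
proof -
  let ?F = "{c. good c \<and> Q c \<and> hdeg c = n \<and> ideg c \<in> M}"
  have fin: "finite ?F" by (rule finite_subset [OF _ finite_cells [of n]]) auto
  have "keys ` chn Q M n = Pow ?F"
  proof (intro equalityI subsetI)
    fix C assume C: "C \<in> Pow ?F"
    then have finC: "finite C" using fin finite_subset by blast
    have "goodvec (\<Sum>c\<in>C. bas c)"
      using keys_sum [of bas C] by (auto simp: goodvec_def bas_def split: if_splits)
    have "lookup (\<Sum>c\<in>C. bas c) d = (if d \<in> C then 1 else 0)" for d
    proof -
      have "lookup (\<Sum>c\<in>C. bas c) d = (\<Sum>c\<in>C. if c = d then 1 else 0)"
        unfolding lookup_sum using C
        by (intro sum.cong) (auto simp: bas_def lookup_single when_def)
      then show ?thesis using finC by simp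
    qed
    then have "keys (\<Sum>c\<in>C. bas c) = C" by (auto simp: in_keys_iff split: if_splits)
    then show "C \<in> keys ` chn Q M n"
      using C by (intro image_eqI [of _ _ "\<Sum>c\<in>C. bas c"]) (auto simp: chn_def)
  qed (auto simp: chn_def)
  moreover have "inj_on keys (chn Q M n)"
    by (rule inj_onI) (rule vec_eqI_keys)
  ultimately have "card (chn Q M n) = card (Pow ?F)"
    by (metis card_image)
  then show ?thesis using fin by (simp add: card_Pow)
qed

lemma cyc_subgroup: "0 \<in> cyc D Q M n" "u \<in> cyc D Q M n \<Longrightarrow> v \<in> cyc D Q M n \<Longrightarrow> u + v \<in> cyc D Q M n"
  by (auto simp: cyc_def chn_add)

lemma bdr_subgroup: "0 \<in> bdr D Q M n" "u \<in> bdr D Q M n \<Longrightarrow> v \<in> bdr D Q M n \<Longrightarrow> u + v \<in> bdr D Q M n"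
proof -
  show "0 \<in> bdr D Q M n" unfolding bdr_def by (intro image_eqI [of _ _ 0]) auto
  show "u + v \<in> bdr D Q M n" if "u \<in> bdr D Q M n" "v \<in> bdr D Q M n"
    using that unfolding bdr_def by (auto simp: chn_add simp flip: lin_add)
qed

lemma finite_cyc: "finite (cyc D Q M n)"
  unfolding cyc_def using finite_chn [of Q M n] by simp

lemma finite_bdr: "finite (bdr D Q M n)"
  unfolding bdr_def using finite_chn by simp

lemma card_cyc_pos: "card (cyc D Q M n) > 0"
  using cyc_subgroup(1) finite_cyc card_gt_0_iff by blast

lemma card_bdr_pos: "card (bdr D Q M n) > 0"
  using bdr_subgroup(1) finite_bdr card_gt_0_iff by blast

text \<open>
  A Morse-type criterion: \<open>S\<close> is a contraction of the quotient by the subcomplex \<open>Q\<close> up to terms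
  that are smaller with respect to \<open>\<mu>\<close>; iterating the correction terminates.
\<close>

locale contraction =
  fixes D S :: "cell \<Rightarrow> cell list" and Q :: "cell \<Rightarrow> bool" and \<mu> :: "cell \<Rightarrow> 'o :: wellorder"
  assumes kills_D: "kills_bad D" and kills_S: "kills_bad S"
    and D_D: "good c \<Longrightarrow> (\<Sum>d\<leftarrow>D c. lsum (D d)) = 0"
    and D_hdeg: "good c \<Longrightarrow> d \<in> set (D c) \<Longrightarrow> good d \<Longrightarrow> Suc (hdeg d) = hdeg c"
    and D_ideg: "good c \<Longrightarrow> d \<in> set (D c) \<Longrightarrow> good d \<Longrightarrow> ideg d = ideg c"
    and S_hdeg: "good c \<Longrightarrow> d \<in> set (S c) \<Longrightarrow> good d \<Longrightarrow> hdeg d = Suc (hdeg c)"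
    and S_ideg: "good c \<Longrightarrow> d \<in> set (S c) \<Longrightarrow> good d \<Longrightarrow> ideg d = ideg c"
    and D_Q: "good c \<Longrightarrow> Q c \<Longrightarrow> d \<in> set (D c) \<Longrightarrow> good d \<Longrightarrow> Q d"
    and S_Q: "good c \<Longrightarrow> Q c \<Longrightarrow> S c = []"
    and decrease: "good c \<Longrightarrow> \<not> Q c \<Longrightarrow>
      keys (bas c + (\<Sum>d\<leftarrow>S c. lsum (D d)) + (\<Sum>d\<leftarrow>D c. lsum (S d))) \<subseteq> {d. Q d \<or> \<mu> d < \<mu> c}"
begin

lemma D_chn: "v \<in> chn R M (Suc n) \<Longrightarrow> lin D v \<in> chn (\<lambda>_. True) M n"
  by (erule chn_linI) (auto dest: D_hdeg D_ideg)

lemma D_chn_Q: "v \<in> chn Q M (Suc n) \<Longrightarrow> lin D v \<in> chn Q M n"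
  by (erule chn_linI) (auto dest: D_hdeg D_ideg D_Q)

lemma S_chn: "v \<in> chn R M n \<Longrightarrow> lin S v \<in> chn (\<lambda>_. True) M (Suc n)"
  by (erule chn_linI) (auto dest: S_hdeg S_ideg)

lemma D_D_vec: "goodvec v \<Longrightarrow> lin D (lin D v) = 0"
  using lin_comp_eq [OF kills_D, of v D "\<lambda>_. []"] D_D by (simp add: goodvec_def lin_def)

lemma S_Q_vec: "v \<in> chn Q M n \<Longrightarrow> lin S v = 0"
  unfolding lin_def using S_Q by (intro sum.neutral) (auto simp: chn_def)

lemma S_D_Q:
  assumes "good c" "Q c"
  shows "(\<Sum>d\<leftarrow>D c. lsum (S d)) = 0"
proof -
  have "lsum (S d) = 0" if "d \<in> set (D c)" for d
    using that D_Q [OF assms] S_Q kills_S by (cases "good d") (auto simp: kills_bad_def)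
  then have "map (\<lambda>d. lsum (S d)) (D c) = map (\<lambda>d. 0) (D c)"
    by (intro map_cong refl)
  then show ?thesis by (simp only: sum_list_0)
qed

text \<open>Induction on a bound \<open>k\<close> for the rank of the cells of \<open>v\<close>
  outside \<open>Q\<close>. Passing to \<open>v + D S v\<close> adds a boundary; since
  \<open>D v\<close> lies in \<open>Q\<close>, where \<open>S\<close> vanishes, the result equals
  \<open>v + D S v + S D v\<close>, whose cells outside \<open>Q\<close> have smaller rank.\<close>

lemma relative_acyclic_aux:
  assumes "v \<in> chn (\<lambda>_. True) M n" "lin D v \<in> chn Q M (n - 1)"
    and "\<And>c. c \<in> keys v \<Longrightarrow> \<not> Q c \<Longrightarrow> \<mu> c \<le> k"
  shows "\<exists>u \<in> chn (\<lambda>_. True) M (Suc n). v + lin D u \<in> chn Q M n"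
  using assms
proof (induction k arbitrary: v rule: less_induct)
  case (less k)
  define w where "w = v + lin D (lin S v)"
  have Sv: "lin S v \<in> chn (\<lambda>_. True) M (Suc n)"
    using less.prems(1) by (rule S_chn)
  have w: "w \<in> chn (\<lambda>_. True) M n"
    unfolding w_def by (intro chn_add less.prems(1) D_chn [OF Sv])
  have Dw: "lin D w = lin D v"
    using D_D_vec [OF goodvec_chn [OF Sv]] by (simp add: w_def)
  have gv: "goodvec v" using less.prems(1) by (rule goodvec_chn)
  define N where "N = (\<lambda>c. bas c + (\<Sum>d\<leftarrow>S c. lsum (D d)) + (\<Sum>d\<leftarrow>D c. lsum (S d)))"
  have "w = v + lin D (lin S v) + lin S (lin D v)"
    using S_Q_vec [OF less.prems(2)] by (simp add: w_def)
  also have "\<dots> = (\<Sum>c\<in>keys v. bas c) + lin D (\<Sum>c\<in>keys v. lsum (S c)) + lin S (\<Sum>c\<in>keys v. lsum (D c))"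
    using goodvec_decomp [OF gv] by (simp add: lin_def [of S v] lin_def [of D v])
  also have "\<dots> = (\<Sum>c\<in>keys v. N c)"
    by (simp only: N_def lin_sum lin_lsum [OF kills_D] lin_lsum [OF kills_S] sum.distrib)
  finally have "keys w \<subseteq> (\<Union>c\<in>keys v. keys (N c))"
    using keys_sum by metis
  also have "\<dots> \<subseteq> {d. Q d \<or> \<mu> d < k}"
  proof (rule UN_least)
    fix c assume c: "c \<in> keys v"
    then have gc: "good c" using gv by (simp add: goodvec_def)
    show "keys (N c) \<subseteq> {d. Q d \<or> \<mu> d < k}"
    proof (cases "Q c")
      case True
      then show ?thesis
        using S_D_Q [OF gc True] S_Q [OF gc True] gc by (simp add: N_def bas_def)
    next
      case False
      then have "\<mu> c \<le> k" using less.prems(3) c by blast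
      then show ?thesis using decrease [OF gc False] unfolding N_def by force
    qed
  qed
  finally have w_less: "\<mu> c < k" if "c \<in> keys w" "\<not> Q c" for c using that by auto
  have "\<exists>u \<in> chn (\<lambda>_. True) M (Suc n). w + lin D u \<in> chn Q M n"
  proof (cases "\<exists>c\<in>keys w. \<not> Q c")
    case False
    with w have "w + lin D 0 \<in> chn Q M n"
      by (auto simp: chn_def)
    then show ?thesis by (intro bexI [of _ 0]) auto
  next
    case True
    let ?C = "{c \<in> keys w. \<not> Q c}"
    define k' where "k' = Max (\<mu> ` ?C)"
    have "k' \<in> \<mu> ` ?C"
      unfolding k'_def using True by (intro Max_in) auto
    then have k': "k' < k" using w_less by auto
    have le: "\<mu> c \<le> k'" if "c \<in> keys w" "\<not> Q c" for c
      unfolding k'_def using that by (intro Max_ge) auto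
    have Dw': "lin D w \<in> chn Q M (n - 1)" using less.prems(2) Dw by simp
    show ?thesis by (rule less.IH [OF k' w Dw' le])
  qed
  then obtain u where u: "u \<in> chn (\<lambda>_. True) M (Suc n)" "w + lin D u \<in> chn Q M n" by blast
  then have "v + lin D (lin S v + u) \<in> chn Q M n"
    by (simp add: w_def add.assoc)
  moreover have "lin S v + u \<in> chn (\<lambda>_. True) M (Suc n)"
    using Sv u(1) by (rule chn_add)
  ultimately show ?case by blast
qed

lemma relative_acyclic:
  assumes "v \<in> chn (\<lambda>_. True) M n" "lin D v \<in> chn Q M (n - 1)"
  shows "\<exists>u \<in> chn (\<lambda>_. True) M (Suc n). v + lin D u \<in> chn Q M n"
proof (rule relative_acyclic_aux [OF assms])
  fix c assume "c \<in> keys v" "\<not> Q c"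
  then show "\<mu> c \<le> Max (\<mu> ` keys v)" by simp
qed

text \<open>Relative acyclicity shows that the total cycles are the sum of the
  \<open>Q\<close>-cycles and the total boundaries, and that these two subgroups meet in the
  \<open>Q\<close>-boundaries; then count the sum.\<close>

theorem card_homology_eq:
  "card (cyc D Q M n) * card (bdr D (\<lambda>_. True) M n) =
   card (cyc D (\<lambda>_. True) M n) * card (bdr D Q M n)"
proof -
  let ?T = "\<lambda>_ :: cell. True"
  have incl: "chn Q M k \<subseteq> chn ?T M k" for k by (rule chn_mono) simp
  have bdr_cyc: "lin D v = 0" if "v \<in> bdr D ?T M n" for v
    using that D_D_vec goodvec_chn unfolding bdr_def by blast
  have "(\<lambda>(x, y). x + y) ` (cyc D Q M n \<times> bdr D ?T M n) = cyc D ?T M n"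
  proof (intro equalityI subsetI)
    fix v assume "v \<in> (\<lambda>(x, y). x + y) ` (cyc D Q M n \<times> bdr D ?T M n)"
    then obtain x y where xy: "v = x + y" "x \<in> cyc D Q M n" "y \<in> bdr D ?T M n" by auto
    from xy(3) have "y \<in> chn ?T M n" unfolding bdr_def using D_chn by blast
    moreover have "x \<in> chn ?T M n" using xy(2) incl unfolding cyc_def by blast
    ultimately show "v \<in> cyc D ?T M n"
      using xy bdr_cyc by (auto simp: cyc_def chn_add)
  next
    fix v assume v: "v \<in> cyc D ?T M n"
    then obtain u where u: "u \<in> chn ?T M (Suc n)" "v + lin D u \<in> chn Q M n"
      using relative_acyclic [of v M n] by (auto simp: cyc_def)
    have "lin D u \<in> bdr D ?T M n" using u(1) by (simp add: bdr_def)
    moreover have "v + lin D u \<in> cyc D Q M n"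
      using u v D_D_vec [OF goodvec_chn [OF u(1)]] by (simp add: cyc_def)
    ultimately show "v \<in> (\<lambda>(x, y). x + y) ` (cyc D Q M n \<times> bdr D ?T M n)"
      by (intro image_eqI [of _ _ "(v + lin D u, lin D u)"]) (simp_all add: add.assoc)
  qed
  moreover have "cyc D Q M n \<inter> bdr D ?T M n = bdr D Q M n"
  proof (intro equalityI subsetI)
    fix v assume v: "v \<in> cyc D Q M n \<inter> bdr D ?T M n"
    then obtain w where w: "w \<in> chn ?T M (Suc n)" "v = lin D w" by (auto simp: bdr_def)
    with v obtain u where u: "u \<in> chn ?T M (Suc (Suc n))" "w + lin D u \<in> chn Q M (Suc n)"
      using relative_acyclic [of w M "Suc n"] by (auto simp: cyc_def)
    have "lin D (w + lin D u) = v"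
      using w D_D_vec [OF goodvec_chn [OF u(1)]] by simp
    with u(2) show "v \<in> bdr D Q M n" unfolding bdr_def by blast
  next
    fix v assume "v \<in> bdr D Q M n"
    then obtain w where w: "w \<in> chn Q M (Suc n)" "v = lin D w" by (auto simp: bdr_def)
    then have "w \<in> chn ?T M (Suc n)" using incl by blast
    then show "v \<in> cyc D Q M n \<inter> bdr D ?T M n"
      using w D_chn_Q D_D_vec [OF goodvec_chn [OF w(1)]] by (auto simp: cyc_def bdr_def)
  qed
  moreover have "card (cyc D Q M n) * card (bdr D ?T M n) =
      card ((\<lambda>(x, y). x + y) ` (cyc D Q M n \<times> bdr D ?T M n)) * card (cyc D Q M n \<inter> bdr D ?T M n)"
    by (rule card_sum_of_subgroups [OF finite_cyc finite_bdr cyc_subgroup bdr_subgroup])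
  ultimately show ?thesis by (simp only:)
qed

end

section \<open>The total complex\<close>

text \<open>The differential of the two-sided bar construction over F_2.\<close>

fun dl :: "mon list \<Rightarrow> mon list list" where
  "dl (a # b # l) = (a * b # l) # map (Cons a) (dl (b # l))"
| "dl _ = []"

fun lmult :: "mon \<Rightarrow> mon list \<Rightarrow> mon list" where
  "lmult c [] = []"
| "lmult c (a # l) = (c * a) # l"

fun rmult :: "mon list \<Rightarrow> mon \<Rightarrow> mon list" where
  "rmult [] c = []"
| "rmult [a] c = [a * c]"
| "rmult (a # b # l) c = a # rmult (b # l) c"

text \<open>On \<open>l = [w', ..., w]\<close> this is the passage from \<open>w x w'\<close> to
  \<open>w c y c' w'\<close>: the left coefficient multiplies the last entry, the right one the
  first.\<close>

definition act :: "mon \<Rightarrow> mon \<Rightarrow> mon list \<Rightarrow> mon list" where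
  "act c c' l = lmult c' (rmult l c)"

lemma length_lmult [simp]: "length (lmult c l) = length l"
  by (cases l) auto

lemma length_rmult [simp]: "length (rmult l c) = length l"
  by (induction l c rule: rmult.induct) auto

lemma length_act [simp]: "length (act c c' l) = length l"
  by (simp add: act_def)

lemma lmult_eq_Nil [simp]: "lmult c l = [] \<longleftrightarrow> l = []"
  by (cases l) auto

lemma rmult_eq_Nil [simp]: "rmult l c = [] \<longleftrightarrow> l = []"
  by (metis length_0_conv length_rmult)

lemma act_eq_Nil [simp]: "act c c' l = [] \<longleftrightarrow> l = []"
  by (simp add: act_def)

lemma rmult_Cons: "l \<noteq> [] \<Longrightarrow> rmult (a # l) c = a # rmult l c"
  by (cases l) auto

lemma lmult_lmult [simp]: "lmult c (lmult e l) = lmult (c * e) l"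
  by (cases l) (auto simp: mult.assoc)

lemma rmult_rmult [simp]: "rmult (rmult l c) e = rmult l (c * e)"
  by (induction l c rule: rmult.induct) (auto simp: mult.assoc rmult_Cons)

lemma rmult_lmult: "rmult (lmult c l) e = lmult c (rmult l e)"
  by (cases "(l, e)" rule: rmult.cases) (auto simp: mult.assoc)

lemma act_act [simp]: "act e e' (act c c' l) = act (c * e) (e' * c') l"
  by (simp add: act_def rmult_lmult)

lemma lmult_One [simp]: "lmult One l = l"
  by (cases l) auto

lemma rmult_One [simp]: "rmult l One = l"
  by (induction l One rule: rmult.induct) auto

lemma dl_nonempty: "k \<in> set (dl l) \<Longrightarrow> k \<noteq> []"
  by (induction l arbitrary: k rule: dl.induct) auto

lemma length_dl: "k \<in> set (dl l) \<Longrightarrow> Suc (length k) = length l"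
  by (induction l arbitrary: k rule: dl.induct) auto

lemma dl_short: "length l < 2 \<Longrightarrow> dl l = []"
  by (cases l rule: dl.cases) auto

lemma dl_lmult: "dl (lmult c l) = map (lmult c) (dl l)"
  by (cases l rule: dl.cases) (auto simp: mult.assoc)

lemma dl_rmult: "dl (rmult l c) = map (\<lambda>k. rmult k c) (dl l)"
proof (induction l rule: dl.induct)
  case (1 a b l)
  have tl: "map (\<lambda>k. rmult k c) (map (Cons a) (dl (b # l))) = map (Cons a) (dl (rmult (b # l) c))"
    using 1 dl_nonempty by (auto simp: rmult_Cons)
  show ?case
  proof (cases l)
    case Nil
    then show ?thesis by (simp add: mult.assoc)
  next
    case (Cons e l')
    then show ?thesis using tl by (simp add: rmult_Cons)
  qed
qed auto

lemma dl_act: "dl (act c c' l) = map (act c c') (dl l)"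
  by (simp add: act_def dl_lmult dl_rmult)

text \<open>Each term of \<open>dl (b # l)\<close> with \<open>a\<close> multiplied into its head
  arises twice: \<open>a\<close> is merged first or last. The rest is the induction hypothesis for
  \<open>b # l\<close>.\<close>

lemma dl_dl:
  fixes g :: "mon list \<Rightarrow> vec"
  shows "(\<Sum>k\<leftarrow>dl l. \<Sum>y\<leftarrow>dl k. g y) = 0"
proof (induction l arbitrary: g rule: dl.induct)
  case (1 a b l)
  have head: "(\<Sum>y\<leftarrow>dl (a * b # l). g y) = (\<Sum>k\<leftarrow>dl (b # l). g (lmult a k))"
    using dl_lmult [of a "b # l"] by (simp add: comp_def)
  have "(\<Sum>y\<leftarrow>dl (a # k). g y) = g (lmult a k) + (\<Sum>y\<leftarrow>dl k. g (a # y))"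
    if "k \<in> set (dl (b # l))" for k
    using dl_nonempty [OF that] by (cases k) (auto simp: comp_def)
  then have "(\<Sum>k\<leftarrow>dl (b # l). \<Sum>y\<leftarrow>dl (a # k). g y) =
      (\<Sum>k\<leftarrow>dl (b # l). g (lmult a k) + (\<Sum>y\<leftarrow>dl k. g (a # y)))"
    by (intro arg_cong [of _ _ sum_list] map_cong refl)
  also have "\<dots> = (\<Sum>k\<leftarrow>dl (b # l). g (lmult a k))"
    using 1 [of "\<lambda>y. g (a # y)"] by (simp add: sum_list_addf)
  finally show ?case
    using head by (simp add: comp_def)
qed auto

text \<open>
  The entries \<open>(c, x', c')\<close> of \<open>dd x\<close> are the terms \<open>c x' c'\<close> of the differential of the
  bimodule generator \<open>x\<close> in the minimal resolution of \<open>A(1)\<close>. They arise from the minimal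
  resolution of the trivial module by letting \<open>w\<close> act as \<open>\<Sum> w\<^sub>1 \<otimes> \<chi>(w\<^sub>2)\<close>; \<open>ad_a\<close>,
  \<open>ad_b\<close>, \<open>ad_ab\<close> and \<open>ad_bab\<close> list the terms of this expression.
\<close>

definition ad_a :: "rgen \<Rightarrow> (mon \<times> rgen \<times> mon) list" where
  "ad_a x = [(One, x, Ma), (Ma, x, One)]"

definition ad_b :: "rgen \<Rightarrow> (mon \<times> rgen \<times> mon) list" where
  "ad_b x = [(One, x, Mb), (Ma, x, Ma), (Mb, x, One)]"

definition ad_ab :: "rgen \<Rightarrow> (mon \<times> rgen \<times> mon) list" where
  "ad_ab x = [(One, x, Mba), (Ma, x, Mb), (Mb, x, Ma), (Mab, x, One)]"

definition ad_bab :: "rgen \<Rightarrow> (mon \<times> rgen \<times> mon) list" where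
  "ad_bab x = [(One, x, Mbab), (Ma, x, Maba), (Mb, x, Mab), (Mb, x, Mba),
               (Mab, x, Mb), (Mba, x, Mb), (Maba, x, Ma), (Mbab, x, One)]"

lemmas ad_defs = ad_a_def ad_b_def ad_ab_def ad_bab_def

fun dd :: "rgen \<Rightarrow> (mon \<times> rgen \<times> mon) list" where
  "dd (X i j) = (case i of 0 \<Rightarrow> [] | Suc i' \<Rightarrow> ad_a (X i' j)) @
                (case j of 0 \<Rightarrow> [] | Suc j' \<Rightarrow> ad_bab (Z i j'))"
| "dd (Y1 j) = ad_b (X 0 j)"
| "dd (Y2 j) = ad_b (Y1 j) @ ad_ab (X (Suc 0) j)"
| "dd (Z i j) = (case i of 0 \<Rightarrow> ad_ab (Y2 j) | Suc i' \<Rightarrow> ad_a (Z i' j)) @ ad_bab (X (Suc (Suc i)) j)"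

lemma dd_degrees:
  assumes "(c, y, c') \<in> set (dd x)"
  shows "rgen_hdeg x = Suc (rgen_hdeg y)" "rgen_ideg x = mon_deg c + rgen_ideg y + mon_deg c'"
  using assms by (cases x; auto simp: ad_defs split: nat.splits)+

text \<open>One operation in two roles: on \<open>[w', a1, ..., aq, w]\<close> it is the
  augmentation of the resolution, with new last entry \<open>w w'\<close>; on
  \<open>[a1, ..., aq, a0]\<close> it is the cyclic face, with last entry
  \<open>a0 a1\<close>.\<close>

definition wrap :: "mon list \<Rightarrow> mon list" where
  "wrap l = rmult (tl l) (hd l)"

text \<open>The bounds \<open>length l \<ge> 2\<close> and \<open>length k \<ge> 2\<close> exclude
  the small cells \<open>L x [w]\<close>, which are not augmented, and the Hochschild chains of
  degree 0, whose boundary is 0.\<close>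

fun D :: "cell \<Rightarrow> cell list" where
  "D (L x l) = map (L x) (dl l) @ map (\<lambda>(c, y, c'). L y (act c c' l)) (dd x) @
     (if x = X 0 0 \<and> length l \<ge> 2 then [H (wrap l)] else [])"
| "D (H k) = map H (dl k) @ (if length k \<ge> 2 then [H (wrap k)] else [])"

declare D.simps [simp del]

lemma Nul_lmult: "l \<noteq> [] \<Longrightarrow> Nul \<in> set (lmult Nul l)"
  by (cases l) auto

lemma Nul_rmult: "l \<noteq> [] \<Longrightarrow> Nul \<in> set (rmult l Nul)"
  by (induction l Nul rule: rmult.induct) auto

lemma Nul_in_lmult: "Nul \<in> set l \<Longrightarrow> Nul \<in> set (lmult c l)"
  by (cases l) auto

lemma Nul_in_rmult: "Nul \<in> set l \<Longrightarrow> Nul \<in> set (rmult l c)"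
  by (induction l c rule: rmult.induct) auto

lemma Nul_in_dl: "Nul \<in> set l \<Longrightarrow> k \<in> set (dl l) \<Longrightarrow> Nul \<in> set k"
  by (induction l arbitrary: k rule: dl.induct) auto

lemma Nul_in_wrap: "Nul \<in> set l \<Longrightarrow> length l \<ge> 2 \<Longrightarrow> Nul \<in> set (wrap l)"
  by (cases l) (auto simp: wrap_def Nul_in_rmult intro!: Nul_rmult)

lemma bas_act_Nul [simp]: "bas (L x (act Nul c l)) = 0" "bas (L x (act c Nul l)) = 0"
proof -
  have "l = [] \<or> Nul \<in> set (act Nul c l)" "l = [] \<or> Nul \<in> set (act c Nul l)"
    using Nul_in_lmult [OF Nul_rmult] Nul_lmult [of "rmult l c"] by (auto simp: act_def)
  then show "bas (L x (act Nul c l)) = 0" "bas (L x (act c Nul l)) = 0"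
    by (auto simp: bas_def)
qed

lemma Nul_in_act: "Nul \<in> set l \<Longrightarrow> Nul \<in> set (act c c' l)"
  unfolding act_def by (intro Nul_in_lmult Nul_in_rmult)

lemma kills_bad_D: "kills_bad D"
  unfolding kills_bad_def
proof (intro allI impI lsum_eq_0)
  fix c d assume "\<not> good c" "d \<in> set (D c)"
  then show "\<not> good d"
    using Nul_in_dl Nul_in_act Nul_in_wrap
    by (cases c) (auto simp: D.simps split: if_splits)
qed

lemma list_deg_simps [simp]: "list_deg [] = 0" "list_deg (a # l) = mon_deg a + list_deg l"
  by (simp_all add: list_deg_def)

lemma list_deg_lmult:
  "l \<noteq> [] \<Longrightarrow> Nul \<notin> set (lmult c l) \<Longrightarrow> list_deg (lmult c l) = mon_deg c + list_deg l"
  by (cases l) (auto simp: mon_deg_mult)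

lemma list_deg_rmult:
  "l \<noteq> [] \<Longrightarrow> Nul \<notin> set (rmult l c) \<Longrightarrow> list_deg (rmult l c) = list_deg l + mon_deg c"
  by (induction l c rule: rmult.induct) (auto simp: mon_deg_mult)

lemma list_deg_act:
  assumes "l \<noteq> []" "Nul \<notin> set (act c c' l)"
  shows "list_deg (act c c' l) = mon_deg c + list_deg l + mon_deg c'"
proof -
  have "Nul \<notin> set (rmult l c)" using assms Nul_in_lmult unfolding act_def by blast
  then show ?thesis using assms by (simp add: act_def list_deg_lmult list_deg_rmult)
qed

lemma list_deg_wrap:
  "length l \<ge> 2 \<Longrightarrow> Nul \<notin> set (wrap l) \<Longrightarrow> list_deg (wrap l) = list_deg l"
  by (cases l rule: dl.cases) (auto simp: wrap_def list_deg_rmult)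

lemma length_wrap: "length (wrap l) = length l - 1"
  by (simp add: wrap_def)

lemma list_deg_dl: "k \<in> set (dl l) \<Longrightarrow> Nul \<notin> set k \<Longrightarrow> list_deg k = list_deg l"
  by (induction l arbitrary: k rule: dl.induct) (auto simp: mon_deg_mult)

lemma D_hdeg: "d \<in> set (D c) \<Longrightarrow> Suc (hdeg d) = hdeg c"
  by (cases c) (auto simp: D.simps length_wrap dest!: length_dl dd_degrees(1) split: if_splits)

lemma D_ideg: "good c \<Longrightarrow> d \<in> set (D c) \<Longrightarrow> good d \<Longrightarrow> ideg d = ideg c"
  by (cases c) (auto simp: D.simps list_deg_wrap list_deg_act list_deg_dl
      dest: dd_degrees(2) split: if_splits)

section \<open>The square of the differential\<close>

lemma dd_dd: "(\<Sum>(c, y, c')\<leftarrow>dd x. \<Sum>(e, z, e')\<leftarrow>dd y. bas (L z (act (c * e) (e' * c') l))) = 0"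
  by (cases x) (simp_all add: ad_defs add_ac split: nat.split)

lemma wrap_act:
  assumes "length l \<ge> 2"
  shows "wrap (act c c' l) = rmult (tl l) (c * c' * hd l)"
  using assms by (cases l rule: dl.cases) (auto simp: wrap_def act_def mult.assoc)

lemma bas_rmult_Nul [simp]: "bas (H (rmult l Nul)) = 0"
  using Nul_rmult [of l] by (auto simp: bas_def)

text \<open>After wrapping only the products \<open>c c'\<close> matter, and by the antipode
  identity they sum to 0 for an adjoint expression of positive degree.\<close>

lemma dd_wrap:
  assumes "length l \<ge> 2"
  shows "(\<Sum>(c, y, c')\<leftarrow>dd x. if y = X 0 0 then bas (H (wrap (act c c' l))) else 0) = 0"
  using assms by (cases x) (simp_all add: ad_defs wrap_act split: nat.split)

text \<open>\<open>wrap\<close> is a chain map from the bar to the Hochschild differential: merging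
  the first two entries becomes the cyclic face \<open>wrap (wrap l)\<close>, the other terms become
  the inner faces. The free \<open>g\<close> admits both \<open>bas\<close> and \<open>lsum\<close>
  of \<open>D\<close>.\<close>

lemma wrap_dl:
  fixes g :: "mon list \<Rightarrow> vec"
  assumes "length l \<ge> 2"
  shows "(\<Sum>y\<leftarrow>dl (wrap l). g y) + (if length (wrap l) \<ge> 2 then g (wrap (wrap l)) else 0) =
    (\<Sum>k\<leftarrow>dl l. if length k \<ge> 2 then g (wrap k) else 0)"
proof -
  from assms obtain u b k where l: "l = u # b # k" by (cases l rule: dl.cases) auto
  have "(\<Sum>y\<leftarrow>dl (b # k). if length (u # y) \<ge> 2 then g (wrap (u # y)) else 0) =
      (\<Sum>y\<leftarrow>dl (b # k). g (rmult y u))"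
    using dl_nonempty [of _ "b # k"]
    by (intro arg_cong [of _ _ sum_list] map_cong) (auto simp: wrap_def Suc_le_eq)
  moreover have "dl (rmult (b # k) u) = map (\<lambda>y. rmult y u) (dl (b # k))"
    by (rule dl_rmult)
  ultimately show ?thesis
    unfolding l by (cases k) (simp_all add: wrap_def comp_def add.commute del: dl.simps(1) add: dl.simps(1) [of u])
qed

lemma sum_list_swap:
  fixes f :: "'a \<Rightarrow> 'b \<Rightarrow> 'c :: comm_monoid_add"
  shows "(\<Sum>x\<leftarrow>xs. \<Sum>y\<leftarrow>ys. f x y) = (\<Sum>y\<leftarrow>ys. \<Sum>x\<leftarrow>xs. f x y)"
  by (induction xs) (auto simp: sum_list_addf)

lemma lsum_map: "lsum (map f xs) = (\<Sum>x\<leftarrow>xs. bas (f x))"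
  by (simp add: lsum_def comp_def)

lemma lsum_D_L: "lsum (D (L x l)) = (\<Sum>k\<leftarrow>dl l. bas (L x k)) +
  (\<Sum>(c, y, c')\<leftarrow>dd x. bas (L y (act c c' l))) +
  (if x = X 0 0 \<and> length l \<ge> 2 then bas (H (wrap l)) else 0)"
  unfolding D.simps lsum_simps lsum_map split_def by (simp add: add.assoc)

lemma lsum_D_H: "lsum (D (H k)) = (\<Sum>y\<leftarrow>dl k. bas (H y)) + (if length k \<ge> 2 then bas (H (wrap k)) else 0)"
  by (simp add: D.simps lsum_map)

text \<open>Since \<open>k = wrap (One # k)\<close>, two uses of \<open>wrap_dl\<close> carry the
  claim back to \<open>dl_dl\<close> for \<open>One # k\<close>.\<close>

lemma D_D_H: "(\<Sum>d\<leftarrow>D (H k). lsum (D d)) = 0"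
proof (cases "k = []")
  case False
  define g where "g l = (if length l \<ge> 2 then bas (H (wrap l)) else 0)" for l
  have len: "length (One # k) \<ge> 2" using False by (cases k) auto
  have *: "lsum (D (H (wrap l))) = (\<Sum>y\<leftarrow>dl l. g y)" if "length l \<ge> 2" for l
    using wrap_dl [OF that, of "\<lambda>y. bas (H y)"] by (simp add: lsum_D_H g_def)
  have "(\<Sum>d\<leftarrow>D (H k). lsum (D d)) =
      (\<Sum>y\<leftarrow>dl k. lsum (D (H y))) + (if length k \<ge> 2 then lsum (D (H (wrap k))) else 0)"
    by (simp add: D.simps comp_def)
  moreover have "wrap (One # k) = k" by (simp add: wrap_def)
  ultimately have "(\<Sum>d\<leftarrow>D (H k). lsum (D d)) = (\<Sum>l\<leftarrow>dl (One # k). if length l \<ge> 2 then lsum (D (H (wrap l))) else 0)"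
    using wrap_dl [OF len, of "\<lambda>y. lsum (D (H y))"] by (simp only:)
  also have "\<dots> = (\<Sum>l\<leftarrow>dl (One # k). \<Sum>y\<leftarrow>dl l. g y)"
    by (intro arg_cong [of _ _ sum_list] map_cong refl) (auto simp: * dl_short)
  also have "\<dots> = 0" by (rule dl_dl)
  finally show ?thesis .
qed (simp add: D.simps)

text \<open>\<open>B\<close>, \<open>R\<close> and \<open>W\<close> are the bar, resolution and
  augmentation parts. The first two commute, hence cancel mod 2; \<open>W\<close> is compatible with
  the bar part and vanishes after the resolution part.\<close>

lemma D_D_L: "(\<Sum>d\<leftarrow>D (L x l). lsum (D d)) = 0"
proof -
  define W where "W x l = (if x = X 0 0 \<and> length l \<ge> 2 then bas (H (wrap l)) else 0)" for x l
  define B where "B x l = (\<Sum>k\<leftarrow>dl l. bas (L x k))" for x l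
  define R where "R x l = (\<Sum>(c, y, c')\<leftarrow>dd x. bas (L y (act c c' l)))" for x l
  have DL: "lsum (D (L x l)) = B x l + R x l + W x l" for x l
    unfolding B_def R_def W_def by (rule lsum_D_L)
  have BB: "(\<Sum>k\<leftarrow>dl l. B x k) = 0" unfolding B_def by (rule dl_dl)
  have RR: "(\<Sum>(c, y, c')\<leftarrow>dd x. R y (act c c' l)) = 0"
    using dd_dd [of l x] by (simp add: R_def)
  have RB: "(\<Sum>(c, y, c')\<leftarrow>dd x. B y (act c c' l)) = (\<Sum>k\<leftarrow>dl l. R x k)"
    unfolding B_def R_def dl_act split_def by (subst sum_list_swap) (simp add: comp_def)
  have RW: "(\<Sum>(c, y, c')\<leftarrow>dd x. W y (act c c' l)) = 0"
    using dd_wrap [of l x] by (cases "length l \<ge> 2") (auto simp: W_def split_def cong: if_cong)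
  have W: "(\<Sum>k\<leftarrow>dl l. W x k) = (if x = X 0 0 \<and> length l \<ge> 2 then lsum (D (H (wrap l))) else 0)"
    using wrap_dl [of l "\<lambda>y. bas (H y)"] by (auto simp: W_def lsum_D_H dl_short)
  have "(\<Sum>d\<leftarrow>D (L x l). lsum (D d)) =
      (\<Sum>k\<leftarrow>dl l. lsum (D (L x k))) + (\<Sum>(c, y, c')\<leftarrow>dd x. lsum (D (L y (act c c' l)))) +
      (if x = X 0 0 \<and> length l \<ge> 2 then lsum (D (H (wrap l))) else 0)"
    by (simp add: D.simps(1) [of x l] comp_def split_def add.assoc)
  also have "\<dots> = 0"
    unfolding DL using BB RR RB RW W
    by (simp add: sum_list_addf split_def add_ac)
  finally show ?thesis .
qed

lemma D_D: "(\<Sum>d\<leftarrow>D c. lsum (D d)) = 0"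
  by (cases c) (simp_all add: D_D_L D_D_H)

section \<open>Two contractions\<close>

fun isH :: "cell \<Rightarrow> bool" where
  "isH (H k) = True" | "isH (L x l) = False"

fun isK :: "cell \<Rightarrow> bool" where
  "isK (H k) = False" | "isK (L x l) \<longleftrightarrow> length l = 1"

text \<open>The extra degeneracy of the bar construction; it contracts each row with fixed
  generator, the small cell \<open>L x [w]\<close> included.\<close>

definition bar_homotopy :: "cell \<Rightarrow> cell list" where
  "bar_homotopy c = (case c of L x l \<Rightarrow> (if l = [] then [] else [L x (One # l)]) | H k \<Rightarrow> [])"

lemma bar_homotopy_simps [simp]:
  "bar_homotopy (L x l) = (if l = [] then [] else [L x (One # l)])" "bar_homotopy (H k) = []"
  by (simp_all add: bar_homotopy_def)

definition bar_rank :: "cell \<Rightarrow> nat" where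
  "bar_rank c = (case c of L x l \<Rightarrow> rgen_hdeg x | H k \<Rightarrow> 0)"

text \<open>For the \<open>dl\<close> part of \<open>D\<close> the homotopy is an exact contraction.
  The surviving terms pass through \<open>dd\<close>, which lowers \<open>rgen_hdeg\<close>, or lie
  in \<open>H\<close>.\<close>

lemma bar_homotopy_decrease:
  assumes "l \<noteq> []"
  shows "keys (bas (L x l) + (\<Sum>d\<leftarrow>bar_homotopy (L x l). lsum (D d)) + (\<Sum>d\<leftarrow>D (L x l). lsum (bar_homotopy d)))
    \<subseteq> {d. isH d \<or> bar_rank d < bar_rank (L x l)}" (is "keys ?N \<subseteq> _")
proof -
  let ?cs = "map (\<lambda>(c, y, c'). L y (act c c' (One # l))) (dd x) @
      map (\<lambda>(c, y, c'). L y (One # act c c' l)) (dd x) @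
      (if x = X 0 0 then [H (wrap (One # l))] else [])"
  have "(\<Sum>k\<leftarrow>dl l. lsum (bar_homotopy (L x k))) = (\<Sum>k\<leftarrow>dl l. bas (L x (One # k)))"
    using dl_nonempty by (intro arg_cong [of _ _ sum_list] map_cong) auto
  moreover have "dl (One # l) = l # map (Cons One) (dl l)"
    using assms by (cases l) auto
  moreover have "length (One # l) \<ge> 2"
    using assms by (cases l) auto
  ultimately have "?N = lsum ?cs"
    using assms
    by (simp add: D.simps(1) [of x l] comp_def split_def lsum_map add_ac)
       (simp add: lsum_D_L comp_def split_def add_ac)
  moreover have "keys (lsum ?cs) \<subseteq> set ?cs" using keys_lsum [of ?cs] by blast
  ultimately have "keys ?N \<subseteq> set ?cs" by (simp only:)
  also have "\<dots> \<subseteq> {d. isH d \<or> bar_rank d < bar_rank (L x l)}"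
    by (auto simp: bar_rank_def dest!: dd_degrees(1))
  finally show ?thesis .
qed

interpretation bar: contraction D bar_homotopy isH bar_rank
proof
  show "kills_bad D" by (rule kills_bad_D)
  show "kills_bad bar_homotopy"
    unfolding kills_bad_def
  proof (intro allI impI lsum_eq_0)
    fix c d assume "\<not> good c" "d \<in> set (bar_homotopy c)"
    then show "\<not> good d" by (cases c) (auto split: if_splits)
  qed
next
  fix c
  show "keys (bas c + (\<Sum>d\<leftarrow>bar_homotopy c. lsum (D d)) + (\<Sum>d\<leftarrow>D c. lsum (bar_homotopy d)))
    \<subseteq> {d. isH d \<or> bar_rank d < bar_rank c}" if "good c" "\<not> isH c"
    using that bar_homotopy_decrease by (cases c) auto
next
  fix c d assume gd: "good c" "isH c" "d \<in> set (D c)"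
  then show "isH d" by (cases c) (auto simp: D.simps split: if_splits)
next
  fix c d assume "good c" "d \<in> set (bar_homotopy c)" "good d"
  then show "hdeg d = Suc (hdeg c)" "ideg d = ideg c"
    by (cases c; auto split: if_splits)+
next
  fix c assume "isH c" then show "bar_homotopy c = []" by (cases c) auto
qed (simp_all add: D_hdeg D_ideg D_D)

section \<open>The contraction in the direction of the resolution\<close>

text \<open>
  \<open>(v, y) \<in> set (matched u x)\<close> means that \<open>x u\<close> is the leading term of the differential of \<open>y v\<close>,
  that is, the term of the form \<open>One x' u'\<close> with \<open>x'\<close> of largest internal degree.
\<close>

fun div_a :: "mon \<Rightarrow> mon list" where
  "div_a Ma = [One]" | "div_a Mab = [Mb]" | "div_a Maba = [Mba]" | "div_a Mabab = [Mbab]" | "div_a _ = []"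

text \<open>Left division by \<open>b\<close>. Although \<open>b b = aba\<close> and
  \<open>b aba = abab\<close>, the monomials \<open>Maba\<close> and \<open>Mabab\<close> are left
  out: over \<open>X 0 j\<close> they are divisible by \<open>a\<close> and already matched with
  \<open>X 1 j\<close>. Over \<open>Y1 j\<close> nothing competes, hence the extra clauses of
  \<open>div_b1\<close>.\<close>

fun div_b0 :: "mon \<Rightarrow> mon list" where
  "div_b0 Mb = [One]" | "div_b0 Mba = [Ma]" | "div_b0 Mbab = [Mab]" | "div_b0 _ = []"

fun div_b1 :: "mon \<Rightarrow> mon list" where
  "div_b1 Maba = [Mb]" | "div_b1 Mabab = [Maba]" | "div_b1 u = div_b0 u"

fun div_ba :: "mon \<Rightarrow> mon list" where
  "div_ba Mba = [One]" | "div_ba Mbab = [Mb]" | "div_ba Mabab = [Mba]" | "div_ba _ = []"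

fun matched :: "mon \<Rightarrow> rgen \<Rightarrow> (mon \<times> rgen) list" where
  "matched u (X i j) = map (\<lambda>v. (v, X (Suc i) j)) (div_a u) @
                       (if i = 0 then map (\<lambda>v. (v, Y1 j)) (div_b0 u) else [])"
| "matched u (Y1 j) = map (\<lambda>v. (v, Y2 j)) (div_b1 u)"
| "matched u (Y2 j) = map (\<lambda>v. (v, Z 0 j)) (div_ba u)"
| "matched u (Z i j) = map (\<lambda>v. (v, Z (Suc i) j)) (div_a u) @
                       (if i = 0 \<and> u = Mbab then [(One, X 0 (Suc j))] else [])"

lemma matched_Nul [simp]: "matched Nul x = []"
  by (cases x) auto

lemma matched_degrees:
  assumes "(v, y) \<in> set (matched u x)"
  shows "rgen_hdeg y = Suc (rgen_hdeg x)" "rgen_ideg y + mon_deg v = rgen_ideg x + mon_deg u"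
  using assms by (cases x; cases u; auto split: if_splits)+

lemma matched_not_X00: "(v, X 0 0) \<notin> set (matched u x)"
  by (cases x) auto

fun res_homotopy :: "cell \<Rightarrow> cell list" where
  "res_homotopy (L x (u # b # k)) = map (\<lambda>(v, y). L y (v # b # k)) (matched u x)"
| "res_homotopy (L x _) = []"
| "res_homotopy (H k) = (if k = [] then [] else [L (X 0 0) (One # k)])"

lemma res_homotopy_length:
  "d \<in> set (res_homotopy (L x l)) \<Longrightarrow> \<exists>y k. d = L y k \<and> length k = length l"
  by (cases "L x l" rule: res_homotopy.cases) auto

text \<open>Terms of \<open>dl\<close> shorten the list. Terms of \<open>dd\<close> with left
  coefficient other than \<open>One\<close> move internal degree from generator and head to the last
  entry. Among the others the leading one has the largest generator. \<open>Suc\<close> gives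
  \<open>H k\<close> the rank of its partner \<open>L (X 0 0) (One # k)\<close>.\<close>

fun res_rank :: "cell \<Rightarrow> nat \<times> nat \<times> nat" where
  "res_rank (L x l) = (length l, rgen_ideg x + mon_deg (hd l), rgen_ideg x)"
| "res_rank (H k) = (Suc (length k), 0, 0)"

definition below :: "cell \<Rightarrow> vec \<Rightarrow> bool" where
  "below c v \<longleftrightarrow> keys v \<subseteq> {d. isK d \<or> res_rank d < res_rank c}"

lemma below_0 [simp]: "below c 0"
  by (simp add: below_def)

lemma below_add: "below c u \<Longrightarrow> below c v \<Longrightarrow> below c (u + v)"
  using Poly_Mapping.keys_add [of u v] unfolding below_def by blast

lemma below_bas: "res_rank d < res_rank c \<Longrightarrow> below c (bas d)"
  by (auto simp: below_def bas_def)

lemma below_sum_list: "(\<And>x. x \<in> set xs \<Longrightarrow> below c (f x)) \<Longrightarrow> below c (\<Sum>x\<leftarrow>xs. f x)"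
  by (induction xs) (auto intro: below_add)

lemma below_lsum: "(\<And>d. d \<in> set ds \<Longrightarrow> res_rank d < res_rank c) \<Longrightarrow> below c (lsum ds)"
  unfolding lsum_def by (intro below_sum_list below_bas)

text \<open>The cell is matched upwards, downwards or, for \<open>X 0 0\<close> with
  \<open>One\<close>, with a Hochschild cell; accordingly a copy of it in the first sum, the second
  sum or the last summand cancels the initial term. The tail \<open>k\<close> enters only through
  \<open>rmult\<close>, so splitting on \<open>x\<close> and \<open>u\<close> suffices.\<close>

lemma matching_decrease:
  assumes "u \<noteq> Nul"
  shows "below (L x (u # k)) (bas (L x (u # k)) +
    (\<Sum>(v, y)\<leftarrow>matched u x. \<Sum>(c, z, c')\<leftarrow>dd y. bas (L z ((c' * v) # rmult k c))) +
    (\<Sum>(c, y, c')\<leftarrow>dd x. \<Sum>(v, z)\<leftarrow>matched (c' * u) y. bas (L z (v # rmult k c))) +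
    (if x = X 0 0 then bas (L (X 0 0) (One # rmult k u)) else 0))"
proof -
  have bad [simp]: "bas (L z (Nul # k)) = 0" for z k
    by (simp add: bas_def)
  show ?thesis
    using assms
    by (cases x; cases u; simp add: ad_defs add_ac split: nat.split; intro allI impI conjI below_add below_bas; simp)
qed

lemma matching_decrease_total:
  assumes "u \<noteq> Nul"
  shows "below (L x (u # b # k)) (bas (L x (u # b # k)) +
    (\<Sum>d\<leftarrow>res_homotopy (L x (u # b # k)). lsum (D d)) +
    (\<Sum>d\<leftarrow>D (L x (u # b # k)). lsum (res_homotopy d)))"
proof -
  let ?k = "b # k"
  let ?c = "L x (u # ?k)"
  have len: "length (u # ?k) \<ge> 2" by simp
  define T1 where "T1 = (\<Sum>(v, y)\<leftarrow>matched u x. \<Sum>(c, z, c')\<leftarrow>dd y. bas (L z ((c' * v) # rmult ?k c)))"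
  define T2 where "T2 = (\<Sum>(c, y, c')\<leftarrow>dd x. \<Sum>(v, z)\<leftarrow>matched (c' * u) y. bas (L z (v # rmult ?k c)))"
  define T3 where "T3 = (if x = X 0 0 then bas (L (X 0 0) (One # rmult ?k u)) else 0)"
  define U1 where "U1 = (\<Sum>(v, y)\<leftarrow>matched u x. \<Sum>z\<leftarrow>dl (v # ?k). bas (L y z))"
  define U2 where "U2 = (\<Sum>z\<leftarrow>dl (u # ?k). lsum (res_homotopy (L x z)))"
  have act: "act c c' (v # ?k) = (c' * v) # rmult ?k c" for c c' v
    by (simp add: act_def)
  have hom: "res_homotopy (L y (v # rmult ?k c)) = map (\<lambda>(w, z). L z (w # rmult ?k c)) (matched v y)" for y v c
    by (cases k) auto
  have "(\<Sum>d\<leftarrow>res_homotopy ?c. lsum (D d)) = (\<Sum>(v, y)\<leftarrow>matched u x. lsum (D (L y (v # ?k))))"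
    by (simp add: comp_def split_def)
  also have "\<dots> = (\<Sum>(v, y)\<leftarrow>matched u x. (\<Sum>z\<leftarrow>dl (v # ?k). bas (L y z)) +
       (\<Sum>(c, z, c')\<leftarrow>dd y. bas (L z ((c' * v) # rmult ?k c))))"
    using matched_not_X00
    by (intro arg_cong [of _ _ sum_list] map_cong refl) (auto simp: lsum_D_L act)
  also have "\<dots> = U1 + T1"
    unfolding U1_def T1_def split_def by (rule sum_list_addf)
  finally have eq1: "(\<Sum>d\<leftarrow>res_homotopy ?c. lsum (D d)) = U1 + T1" .
  have "(\<Sum>d\<leftarrow>D ?c. lsum (res_homotopy d)) = U2 +
      (\<Sum>(c, y, c')\<leftarrow>dd x. lsum (res_homotopy (L y (act c c' (u # ?k))))) +
      (if x = X 0 0 then lsum (res_homotopy (H (wrap (u # ?k)))) else 0)"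
    unfolding D.simps U2_def by (simp add: comp_def split_def add.assoc)
  also have "\<dots> = U2 + T2 + T3"
    unfolding act hom T2_def T3_def lsum_map by (simp add: wrap_def lsum_map split_def)
  finally have eq2: "(\<Sum>d\<leftarrow>D ?c. lsum (res_homotopy d)) = U2 + T2 + T3" .
  \<comment> \<open>The faces in \<open>U1\<close> and \<open>U2\<close> have shorter lists; the
    matching is used only for the part that keeps the length.\<close>
  have "below ?c U1"
    unfolding U1_def by (auto intro!: below_sum_list below_bas dest!: length_dl simp del: dl.simps)
  moreover have "below ?c U2"
    unfolding U2_def
  proof (intro below_sum_list below_lsum)
    fix z d assume "z \<in> set (dl (u # ?k))" "d \<in> set (res_homotopy (L x z))"
    then show "res_rank d < res_rank ?c"
      using length_dl [of z "u # ?k"] res_homotopy_length [of d x z] by auto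
  qed
  moreover have "below ?c (bas ?c + T1 + T2 + T3)"
    using matching_decrease [OF assms, of x ?k] unfolding T1_def T2_def T3_def .
  ultimately have "below ?c (U1 + (U2 + (bas ?c + T1 + T2 + T3)))"
    using below_add by blast
  then show ?thesis
    unfolding eq1 eq2 by (simp add: add_ac)
qed

lemma res_decrease_H:
  assumes "l \<noteq> []"
  shows "below (H l) (bas (H l) + (\<Sum>d\<leftarrow>res_homotopy (H l). lsum (D d)) +
    (\<Sum>d\<leftarrow>D (H l). lsum (res_homotopy d)))"
proof -
  have "length (One # l) \<ge> 2" using assms by (cases l) auto
  then have "bas (H l) + (\<Sum>d\<leftarrow>res_homotopy (H l). lsum (D d)) =
      (\<Sum>k\<leftarrow>dl (One # l). bas (L (X 0 0) k))"
    using assms by (simp add: lsum_D_L wrap_def add_ac)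
  moreover have "below (H l) (\<Sum>k\<leftarrow>dl (One # l). bas (L (X 0 0) k))"
    by (auto intro!: below_sum_list below_bas dest!: length_dl simp del: dl.simps)
  moreover have "below (H l) (\<Sum>d\<leftarrow>D (H l). lsum (res_homotopy d))"
  proof (intro below_sum_list below_lsum)
    fix d e assume "d \<in> set (D (H l))" "e \<in> set (res_homotopy d)"
    then have "\<exists>y w. e = L y w \<and> length w = length l"
      using assms by (auto dest!: length_dl simp: D.simps length_wrap split: if_splits)
    then show "res_rank e < res_rank (H l)" by auto
  qed
  ultimately show ?thesis by (auto intro: below_add)
qed

interpretation res: contraction D res_homotopy isK res_rank
proof
  show "kills_bad D" by (rule kills_bad_D)
  show "kills_bad res_homotopy"
    unfolding kills_bad_def
  proof (intro allI impI lsum_eq_0)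
    fix c d assume "\<not> good c" "d \<in> set (res_homotopy c)"
    then show "\<not> good d" by (cases c rule: res_homotopy.cases) (auto split: if_splits)
  qed
next
  fix c
  show "keys (bas c + (\<Sum>d\<leftarrow>res_homotopy c. lsum (D d)) + (\<Sum>d\<leftarrow>D c. lsum (res_homotopy d)))
    \<subseteq> {d. isK d \<or> res_rank d < res_rank c}" if "good c" "\<not> isK c"
    unfolding below_def [symmetric]
  proof (cases c rule: res_homotopy.cases)
    case (1 x u b k)
    then show "below c (bas c + (\<Sum>d\<leftarrow>res_homotopy c. lsum (D d)) + (\<Sum>d\<leftarrow>D c. lsum (res_homotopy d)))"
      using that matching_decrease_total [of u x b k] by (simp only: good.simps) auto
  next
    case (3 l)
    then show "below c (bas c + (\<Sum>d\<leftarrow>res_homotopy c. lsum (D d)) + (\<Sum>d\<leftarrow>D c. lsum (res_homotopy d)))"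
      using that res_decrease_H [of l] by (simp only: good.simps) blast
  qed (use that in auto)
next
  fix c d assume "good c" "isK c" "d \<in> set (D c)"
  then show "isK d" by (cases c) (auto simp: D.simps dl_short split: if_splits)
next
  fix c d assume "good c" "d \<in> set (res_homotopy c)" "good d"
  then show "hdeg d = Suc (hdeg c)" "ideg d = ideg c"
    by (cases c rule: res_homotopy.cases; auto dest: matched_degrees split: if_splits)+
next
  fix c assume "isK c" then show "res_homotopy c = []"
    by (cases c rule: res_homotopy.cases) auto
qed (simp_all add: D_hdeg D_ideg D_D)

theorem card_homology_H_K:
  "card (cyc D isH M n) * card (bdr D isK M n) = card (cyc D isK M n) * card (bdr D isH M n)"
proof -
  let ?T = "\<lambda>_ :: cell. True"
  have "(card (cyc D isH M n) * card (bdr D isK M n)) * (card (cyc D ?T M n) * card (bdr D ?T M n)) =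
    (card (cyc D isH M n) * card (bdr D ?T M n)) * (card (cyc D ?T M n) * card (bdr D isK M n))"
    by (simp add: ac_simps)
  also have "\<dots> = (card (cyc D ?T M n) * card (bdr D isH M n)) * (card (cyc D isK M n) * card (bdr D ?T M n))"
    by (simp only: bar.card_homology_eq res.card_homology_eq)
  also have "\<dots> = (card (cyc D isK M n) * card (bdr D isH M n)) * (card (cyc D ?T M n) * card (bdr D ?T M n))"
    by (simp add: ac_simps)
  finally show ?thesis
    using card_cyc_pos [of D ?T M n] card_bdr_pos [of D ?T M n] by auto
qed

section \<open>Homology of the small complex\<close>

text \<open>
  On the small complex a product of two generators of \<open>A(1)\<close> acts trivially, so only the terms
  \<open>ad_a\<close> and \<open>ad_b\<close> of \<open>dd\<close> contribute there. The monomials in \<open>crit x\<close> index a basis of the homology,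
  with projection \<open>kpi\<close>, cycle representatives \<open>kio\<close> and contracting homotopy \<open>kh\<close>.
\<close>

fun crit :: "rgen \<Rightarrow> mon list" where
  "crit (X i j) = (if i = 0 then [One, Ma, Mb, Mab, Mabab] else [One, Ma, Mbab, Mabab])"
| "crit (Y1 j) = [One, Ma, Mb, Mabab]"
| "crit (Y2 j) = [One, Mba, Maba, Mbab, Mabab]"
| "crit (Z i j) = (if i = 0 then [One, Ma, Mb, Mab, Mbab, Mabab] else [One, Ma, Mbab, Mabab])"

text \<open>Inverts the surviving differentials: the commutators of \<open>a\<close> with
  \<open>b\<close> and \<open>ab\<close> are \<open>ab + ba\<close> and \<open>aba\<close>, and the
  adjoint action of \<open>b\<close> sends \<open>a\<close>, \<open>b\<close>, \<open>ab\<close> to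
  \<open>ab + ba\<close>, \<open>aba\<close>, \<open>bab\<close>.\<close>

fun kh :: "rgen \<Rightarrow> mon \<Rightarrow> (rgen \<times> mon) list" where
  "kh (X i j) w = (if w = Mba then [(X (Suc i) j, Mb)] else if w = Maba then [(X (Suc i) j, Mab)]
     else if w = Mbab \<and> i = 0 then [(Y1 j, Mab)] else [])"
| "kh (Y1 j) w = (if w = Mba then [(Y2 j, Ma)] else if w = Maba then [(Y2 j, Mb)]
     else if w = Mbab then [(Y2 j, Mab)] else [])"
| "kh (Y2 j) w = []"
| "kh (Z i j) w = (if w = Mba then [(Z (Suc i) j, Mb)] else if w = Maba then [(Z (Suc i) j, Mab)] else [])"

text \<open>The boundary \<open>ab + ba\<close> identifies \<open>Mba\<close> with
  \<open>Mab\<close> where the latter is a basis class.\<close>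

definition kpi :: "rgen \<Rightarrow> mon \<Rightarrow> (rgen \<times> mon) list" where
  "kpi x w = (if w \<in> set (crit x) then [(x, w)]
     else if w = Mba \<and> Mab \<in> set (crit x) then [(x, Mab)] else [])"

text \<open>\<open>Ma\<close> and \<open>Mb\<close> at \<open>Y1 j\<close> are not cycles; their
  boundaries \<open>ab + ba\<close> and \<open>aba\<close> are also the commutators of
  \<open>a\<close> with \<open>b\<close> and \<open>ab\<close>, whence the corrections at
  \<open>X 1 j\<close>. At \<open>Y2 j\<close> the kernel contains \<open>ab + ba\<close> but not
  \<open>ba\<close>.\<close>

fun kio :: "rgen \<Rightarrow> mon \<Rightarrow> (rgen \<times> mon) list" where
  "kio (Y1 j) w = (Y1 j, w) # (if w = Ma then [(X 1 j, Mb)] else if w = Mb then [(X 1 j, Mab)] else [])"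
| "kio (Y2 j) w = (Y2 j, w) # (if w = Mba then [(Y2 j, Mab)] else [])"
| "kio x w = [(x, w)]"

fun on_K :: "(rgen \<Rightarrow> mon \<Rightarrow> (rgen \<times> mon) list) \<Rightarrow> cell \<Rightarrow> cell list" where
  "on_K f (L x [w]) = (if w = Nul then [] else map (\<lambda>(y, v). L y [v]) (f x w))"
| "on_K f _ = []"

fun isW :: "cell \<Rightarrow> bool" where
  "isW (L x [w]) \<longleftrightarrow> w \<in> set (crit x)" | "isW _ \<longleftrightarrow> False"

lemma kills_bad_on_K: "kills_bad (on_K f)"
  unfolding kills_bad_def
proof (intro allI impI lsum_eq_0)
  fix c d assume "\<not> good c" "d \<in> set (on_K f c)"
  then show "\<not> good d" by (cases "(f, c)" rule: on_K.cases) auto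
qed

lemma D_K: "D (L x [w]) = map (\<lambda>(c, y, c'). L y [c' * (w * c)]) (dd x)"
  by (simp add: D.simps act_def)

lemma K_pi_D: "w \<noteq> Nul \<Longrightarrow> (\<Sum>d\<leftarrow>D (L x [w]). lsum (on_K kpi d)) = 0"
  by (cases x; cases w; simp add: D_K ad_defs kpi_def split: nat.split)

lemma K_pi_iota: "w \<in> set (crit x) \<Longrightarrow> (\<Sum>d\<leftarrow>on_K kio (L x [w]). lsum (on_K kpi d)) = bas (L x [w])"
  by (cases x; cases w; simp add: kpi_def split: if_splits)

lemma K_D_iota: "w \<in> set (crit x) \<Longrightarrow> (\<Sum>d\<leftarrow>on_K kio (L x [w]). lsum (D d)) = 0"
proof -
  have [simp]: "bas (L y [Nul]) = 0" for y by (simp add: bas_def)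
  show "w \<in> set (crit x) \<Longrightarrow> (\<Sum>d\<leftarrow>on_K kio (L x [w]). lsum (D d)) = 0"
    by (cases x; cases w; simp add: D_K ad_defs add_ac split: if_splits nat.split)
qed

lemma K_homotopy: "w \<noteq> Nul \<Longrightarrow>
  bas (L x [w]) + (\<Sum>d\<leftarrow>on_K kh (L x [w]). lsum (D d)) + (\<Sum>d\<leftarrow>D (L x [w]). lsum (on_K kh d))
   = (\<Sum>d\<leftarrow>on_K kpi (L x [w]). lsum (on_K kio d))"
proof -
  have [simp]: "bas (L y [Nul]) = 0" for y by (simp add: bas_def)
  show "w \<noteq> Nul \<Longrightarrow>
    bas (L x [w]) + (\<Sum>d\<leftarrow>on_K kh (L x [w]). lsum (D d)) + (\<Sum>d\<leftarrow>D (L x [w]). lsum (on_K kh d))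
     = (\<Sum>d\<leftarrow>on_K kpi (L x [w]). lsum (on_K kio d))"
    by (cases x; cases w; simp add: D_K ad_defs kpi_def add_ac split: nat.split)
qed

lemma good_K: "good c \<Longrightarrow> isK c \<Longrightarrow> \<exists>x w. c = L x [w] \<and> w \<noteq> Nul"
proof (cases c)
  case (L x l)
  then show "good c \<Longrightarrow> isK c \<Longrightarrow> ?thesis" by (cases l) auto
qed auto

lemma kh_degrees:
  "(y, v) \<in> set (kh x w) \<Longrightarrow> rgen_hdeg y = Suc (rgen_hdeg x) \<and> rgen_ideg y + mon_deg v = rgen_ideg x + mon_deg w"
  by (cases x) (auto split: if_splits)

lemma kio_degrees:
  "(y, v) \<in> set (kio x w) \<Longrightarrow> rgen_hdeg y = rgen_hdeg x \<and> rgen_ideg y + mon_deg v = rgen_ideg x + mon_deg w"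
  by (cases x) (auto split: if_splits)

lemma K_degrees:
  "d \<in> set (on_K kpi c) \<Longrightarrow> hdeg d = hdeg c \<and> ideg d = ideg c \<and> isW d"
  "d \<in> set (on_K kh c) \<Longrightarrow> hdeg d = Suc (hdeg c) \<and> ideg d = ideg c \<and> isK d"
  by (cases "(kpi, c)" rule: on_K.cases; auto simp: kpi_def split: if_splits)
     (cases "(kh, c)" rule: on_K.cases; auto dest!: kh_degrees split: if_splits)

lemma K_degrees_iota:
  "d \<in> set (on_K kio c) \<Longrightarrow> hdeg d = hdeg c \<and> ideg d = ideg c \<and> isK d"
  by (cases "(kio, c)" rule: on_K.cases; auto dest!: kio_degrees split: if_splits)

lemma lin_comp_0:
  assumes "kills_bad g" "goodvec v" "\<And>c. c \<in> keys v \<Longrightarrow> (\<Sum>d\<leftarrow>f c. lsum (g d)) = 0"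
  shows "lin g (lin f v) = 0"
  using lin_comp_eq [OF assms(1,2), of f "\<lambda>_. []"] assms(3) by (simp add: lin_def [of "\<lambda>_. []"])

lemma isW_imp: "isW c \<Longrightarrow> isK c \<and> good c \<and> (\<exists>x w. c = L x [w] \<and> w \<in> set (crit x))"
proof (cases c rule: isW.cases)
  case (1 x w)
  then show "isW c \<Longrightarrow> ?thesis" by (cases x) (auto split: if_splits)
qed auto

lemma chn_W_cell: "v \<in> chn isW M n \<Longrightarrow> c \<in> keys v \<Longrightarrow> \<exists>x w. c = L x [w] \<and> w \<in> set (crit x)"
  using isW_imp unfolding chn_def by blast

lemma chn_K_cell: "v \<in> chn isK M n \<Longrightarrow> c \<in> keys v \<Longrightarrow> \<exists>x w. c = L x [w] \<and> w \<noteq> Nul"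
  using good_K unfolding chn_def by blast

text \<open>\<open>on_K kpi\<close> maps the cycles onto all chains of critical cells, annihilates
  boundaries and, by \<open>K_homotopy\<close>, no other cycle.\<close>

theorem card_homology_K:
  "card (cyc D isK M n) = 2 ^ card {c. isW c \<and> hdeg c = n \<and> ideg c \<in> M} * card (bdr D isK M n)"
proof -
  have image: "lin (on_K kpi) ` cyc D isK M n = chn isW M n"
  proof (intro equalityI subsetI)
    fix v assume "v \<in> lin (on_K kpi) ` cyc D isK M n"
    then obtain u where u: "u \<in> chn isK M n" "v = lin (on_K kpi) u" by (auto simp: cyc_def)
    show "v \<in> chn isW M n"
      unfolding u(2) using K_degrees(1) by (intro chn_linI [OF u(1)]) blast
  next
    fix v assume v: "v \<in> chn isW M n"
    let ?u = "lin (on_K kio) v"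
    have "?u \<in> chn isK M n"
      using K_degrees_iota by (intro chn_linI [OF v]) blast
    moreover have "lin D ?u = 0"
      using chn_W_cell [OF v] K_D_iota by (intro lin_comp_0 kills_bad_D goodvec_chn [OF v]) blast
    moreover have "lin (on_K kpi) ?u = v"
    proof -
      have "lin (on_K kpi) ?u = lin (\<lambda>c. [c]) v"
      proof (intro lin_comp_eq kills_bad_on_K goodvec_chn [OF v])
        fix c assume "c \<in> keys v"
        then obtain x w where "c = L x [w]" "w \<in> set (crit x)" using chn_W_cell [OF v] by blast
        then show "(\<Sum>d\<leftarrow>on_K kio c. lsum (on_K kpi d)) = lsum [c]"
          using K_pi_iota by simp
      qed
      also have "\<dots> = v"
        using goodvec_decomp [OF goodvec_chn [OF v]] by (simp add: lin_def)
      finally show ?thesis .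
    qed
    ultimately show "v \<in> lin (on_K kpi) ` cyc D isK M n"
      by (intro image_eqI [of _ _ ?u]) (simp_all add: cyc_def)
  qed
  have kernel: "{v \<in> cyc D isK M n. lin (on_K kpi) v = 0} = bdr D isK M n"
  proof (intro equalityI subsetI)
    fix v assume "v \<in> {v \<in> cyc D isK M n. lin (on_K kpi) v = 0}"
    then have v: "v \<in> chn isK M n" "lin D v = 0" "lin (on_K kpi) v = 0" by (auto simp: cyc_def)
    have gv: "goodvec v" using v(1) by (rule goodvec_chn)
    have kv: "lin (on_K kh) v \<in> chn isK M (Suc n)"
      using K_degrees(2) by (intro chn_linI [OF v(1)]) blast
    have "v + lin D (lin (on_K kh) v) + lin (on_K kh) (lin D v) =
        (\<Sum>c\<in>keys v. bas c) + lin D (\<Sum>c\<in>keys v. lsum (on_K kh c)) + lin (on_K kh) (\<Sum>c\<in>keys v. lsum (D c))"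
      using goodvec_decomp [OF gv] by (simp add: lin_def [of _ v])
    also have "\<dots> = (\<Sum>c\<in>keys v. bas c + (\<Sum>d\<leftarrow>on_K kh c. lsum (D d)) + (\<Sum>d\<leftarrow>D c. lsum (on_K kh d)))"
      by (simp only: lin_sum lin_lsum [OF kills_bad_D] lin_lsum [OF kills_bad_on_K] sum.distrib)
    also have "\<dots> = (\<Sum>c\<in>keys v. \<Sum>d\<leftarrow>on_K kpi c. lsum (on_K kio d))"
    proof (rule sum.cong [OF refl])
      fix c assume "c \<in> keys v"
      then obtain x w where "c = L x [w]" "w \<noteq> Nul" using chn_K_cell [OF v(1)] by blast
      then show "bas c + (\<Sum>d\<leftarrow>on_K kh c. lsum (D d)) + (\<Sum>d\<leftarrow>D c. lsum (on_K kh d)) =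
          (\<Sum>d\<leftarrow>on_K kpi c. lsum (on_K kio d))"
        using K_homotopy by blast
    qed
    also have "\<dots> = lin (on_K kio) (lin (on_K kpi) v)"
      by (simp add: lin_def [of _ v] lin_sum lin_lsum kills_bad_on_K)
    finally have "v + lin D (lin (on_K kh) v) = 0" using v by simp
    then have "v = lin D (lin (on_K kh) v)" by (rule vec_eq_iff_add [THEN iffD2])
    then show "v \<in> bdr D isK M n" unfolding bdr_def using kv by blast
  next
    fix v assume "v \<in> bdr D isK M n"
    then obtain u where u: "u \<in> chn isK M (Suc n)" "v = lin D u" by (auto simp: bdr_def)
    have gu: "goodvec u" using u(1) by (rule goodvec_chn)
    have isK_D: "isK d" if "isK c" "d \<in> set (D c)" for c d
      using that by (cases c) (auto simp: D.simps dl_short split: if_splits)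
    have "v \<in> chn isK M n"
      unfolding u(2) by (intro chn_linI [OF u(1)]) (auto dest: D_hdeg D_ideg isK_D)
    moreover have "lin D v = 0"
      unfolding u(2) by (intro lin_comp_0 kills_bad_D gu D_D)
    moreover have "lin (on_K kpi) v = 0"
      unfolding u(2) using chn_K_cell [OF u(1)] K_pi_D by (intro lin_comp_0 kills_bad_on_K gu) blast
    ultimately show "v \<in> {v \<in> cyc D isK M n. lin (on_K kpi) v = 0}" by (simp add: cyc_def)
  qed
  have "card (cyc D isK M n) = card (lin (on_K kpi) ` cyc D isK M n) *
      card {v \<in> cyc D isK M n. lin (on_K kpi) v = 0}"
    by (intro card_hom finite_cyc cyc_subgroup lin_add)
  also have "\<dots> = card (chn isW M n) * card (bdr D isK M n)"
    unfolding image kernel ..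
  also have "{c. good c \<and> isW c \<and> hdeg c = n \<and> ideg c \<in> M} = {c. isW c \<and> hdeg c = n \<and> ideg c \<in> M}"
    using isW_imp by blast
  then have "card (chn isW M n) = 2 ^ card {c. isW c \<and> hdeg c = n \<and> ideg c \<in> M}"
    by (simp add: card_chn)
  finally show ?thesis .
qed

section \<open>Comparison with the Hochschild complex\<close>

text \<open>\<open>Nul\<close> goes to a word outside \<open>A1_basis\<close> that evaluates to 0,
  so that \<open>word_mon\<close> is a left inverse without side condition.\<close>

fun mon_word :: "mon \<Rightarrow> word" where
  "mon_word Nul = [Sq1, Sq1]"
| "mon_word One = []"
| "mon_word Ma = [Sq1]"
| "mon_word Mb = [Sq2]"
| "mon_word Mab = [Sq1, Sq2]"
| "mon_word Mba = [Sq2, Sq1]"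
| "mon_word Maba = [Sq1, Sq2, Sq1]"
| "mon_word Mbab = [Sq2, Sq1, Sq2]"
| "mon_word Mabab = [Sq1, Sq2, Sq1, Sq2]"

fun gen_mon :: "gen \<Rightarrow> mon" where
  "gen_mon Sq1 = Ma" | "gen_mon Sq2 = Mb"

definition word_mon :: "word \<Rightarrow> mon" where
  "word_mon w = fold (\<lambda>g m. m * gen_mon g) w One"

lemma word_mon_mon_word [simp]: "word_mon (mon_word m) = m"
  by (cases m) (simp_all add: word_mon_def)

lemma A1_basis_eq: "A1_basis = mon_word ` (- {Nul})"
proof -
  have "- {Nul} = {One, Ma, Mb, Mab, Mba, Maba, Mbab, Mabab}"
    using UNIV_mon by auto
  then show ?thesis by (auto simp: A1_basis_def)
qed

lemma mon_word_word_mon: "w \<in> A1_basis \<Longrightarrow> mon_word (word_mon w) = w"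
  by (auto simp: A1_basis_eq)

lemma word_mon_Nul: "w \<in> A1_basis \<Longrightarrow> word_mon w \<noteq> Nul"
  by (auto simp: A1_basis_eq)

lemma mult_mon_word:
  "m \<noteq> Nul \<Longrightarrow> m' \<noteq> Nul \<Longrightarrow>
   mult (mon_word m) (mon_word m') = (if m * m' = Nul then None else Some (mon_word (m * m')))"
  by (cases m; cases m'; simp)

lemma word_deg_mon_word: "m \<noteq> Nul \<Longrightarrow> word_deg (mon_word m) = mon_deg m"
  by (cases m) (simp_all add: word_deg_def)

text \<open>The coefficient \<open>a0\<close> stands last in a cell, which makes
  \<open>aq a0\<close> an ordinary \<open>dl\<close> term, but first in a Hochschild tuple.\<close>

definition tuple_of :: "mon list \<Rightarrow> word list" where
  "tuple_of k = map mon_word (last k # butlast k)"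

definition list_of :: "word list \<Rightarrow> mon list" where
  "list_of t = map word_mon (rotate1 t)"

lemma tuple_of_snoc [simp]: "tuple_of (k @ [a]) = map mon_word (a # k)"
  by (simp add: tuple_of_def)

lemma list_of_tuple_of: "k \<noteq> [] \<Longrightarrow> list_of (tuple_of k) = k"
  by (cases k rule: rev_cases) (auto simp: list_of_def comp_def)

lemma tuple_of_list_of:
  assumes "t \<noteq> []" "set t \<subseteq> A1_basis"
  shows "tuple_of (list_of t) = t"
proof -
  have "map (mon_word \<circ> word_mon) t = t"
    using assms(2) by (intro map_idI) (auto simp: mon_word_word_mon)
  then show ?thesis
    using assms(1) by (cases t) (auto simp: list_of_def)
qed

lemma tuple_of_in_tuples: "good (H k) \<Longrightarrow> length k = Suc n \<Longrightarrow> tuple_of k \<in> tuples n"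
  by (cases k rule: rev_cases) (auto simp: tuples_def A1_basis_eq)

lemma tuple_deg_tuple_of:
  assumes "good (H k)"
  shows "tuple_deg (tuple_of k) = list_deg k"
proof -
  from assms obtain l a where k: "k = l @ [a]" by (cases k rule: rev_cases) auto
  have "(\<Sum>x\<leftarrow>l. word_deg (mon_word x)) = (\<Sum>x\<leftarrow>l. mon_deg x)"
    using assms k by (intro arg_cong [of _ _ sum_list] map_cong) (auto intro!: word_deg_mon_word)
  then show ?thesis
    using assms k word_deg_mon_word [of a] by (auto simp: tuple_deg_def list_deg_def comp_def)
qed

lemma good_list_of: "t \<in> tuples n \<Longrightarrow> good (H (list_of t))"
  by (auto simp: tuples_def list_of_def dest!: word_mon_Nul)

lemma length_list_of [simp]: "length (list_of t) = length t"
  by (simp add: list_of_def)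

text \<open>The guard matters because \<open>list_of\<close> separates only tuples of normal forms:
  \<open>[Sq2, Sq2]\<close> and \<open>[Sq1, Sq2, Sq1]\<close> evaluate to the same
  monomial.\<close>

definition to_chain :: "vec \<Rightarrow> chain" where
  "to_chain v = (\<lambda>t. if t \<noteq> [] \<and> set t \<subseteq> A1_basis then lookup v (H (list_of t)) else 0)"

lemma to_chain_add: "to_chain (u + v) = to_chain u + to_chain v"
  by (auto simp: to_chain_def lookup_add)

lemma to_chain_0 [simp]: "to_chain 0 = 0"
  by (auto simp: to_chain_def)

lemma to_chain_sum: "to_chain (sum f A) = (\<Sum>x\<in>A. to_chain (f x))"
  by (induction A rule: infinite_finite_induct) (auto simp: to_chain_add)

lemma to_chain_bas: "to_chain (bas (H k)) = (if good (H k) then basis_vec (tuple_of k) else 0)"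
proof (cases "good (H k)")
  case True
  then have k: "k \<noteq> []" "Nul \<notin> set k" by auto
  have tup: "tuple_of k \<noteq> []" "set (tuple_of k) \<subseteq> A1_basis"
    using tuple_of_in_tuples [OF True, of "length k - 1"] k by (auto simp: tuples_def)
  have "to_chain (bas (H k)) t = basis_vec (tuple_of k) t" for t
  proof (cases "t \<noteq> [] \<and> set t \<subseteq> A1_basis")
    case t: True
    then have "list_of t = k \<longleftrightarrow> t = tuple_of k"
      using list_of_tuple_of [OF k(1)] tuple_of_list_of [of t] by metis
    then show ?thesis
      using t True unfolding to_chain_def bas_def basis_vec_def
      by (simp add: lookup_single when_def eq_commute)
  next
    case False
    then show ?thesis using tup by (auto simp: to_chain_def basis_vec_def)
  qed
  then show ?thesis using True by (simp add: fun_eq_iff)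
qed (simp add: bas_def del: good.simps)

definition chains_in :: "nat \<Rightarrow> nat set \<Rightarrow> chain set" where
  "chains_in n M = {f \<in> chains n. \<forall>t. f t \<noteq> 0 \<longrightarrow> tuple_deg t \<in> M}"

lemma finite_tuples: "finite (tuples n)"
proof -
  have "finite A1_basis" by (simp add: A1_basis_def)
  then show ?thesis
    using finite_lists_length_eq [of A1_basis "n + 1"] by (simp add: tuples_def conj_commute)
qed

lemma to_chain_inj: "inj_on to_chain (chn isH M n)"
proof (rule inj_onI)
  fix u v assume uv: "u \<in> chn isH M n" "v \<in> chn isH M n" "to_chain u = to_chain v"
  show "u = v"
  proof (rule poly_mapping_eqI)
    fix c
    show "lookup u c = lookup v c"
    proof (cases "isH c \<and> good c")
      case True
      then obtain k where c: "c = H k" "good (H k)" by (cases c) auto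
      then have "tuple_of k \<noteq> []" "set (tuple_of k) \<subseteq> A1_basis" "list_of (tuple_of k) = k"
        using tuple_of_in_tuples [of k "length k - 1"] list_of_tuple_of by (auto simp: tuples_def)
      then show ?thesis
        using fun_cong [OF uv(3), of "tuple_of k"] c by (simp add: to_chain_def)
    next
      case False
      then have "c \<notin> keys u" "c \<notin> keys v" using uv by (auto simp: chn_def)
      then show ?thesis by (simp add: in_keys_iff)
    qed
  qed
qed

lemma sum_apply: "(\<Sum>x\<in>A. f x :: chain) s = (\<Sum>x\<in>A. f x s)"
  by (induction A rule: infinite_finite_induct) auto

lemma chain_eq_sum:
  assumes "f \<in> chains n"
  shows "f = (\<Sum>t\<in>{t \<in> tuples n. f t = 1}. basis_vec t)"
proof
  fix s
  have "(\<Sum>t\<in>{t \<in> tuples n. f t = 1}. basis_vec t) s = (\<Sum>t\<in>{t \<in> tuples n. f t = 1}. basis_vec t s)"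
    by (rule sum_apply)
  also have "\<dots> = f s"
    using assms finite_tuples [of n] by (cases "f s = 1") (auto simp: basis_vec_def chains_def)
  finally show "f s = (\<Sum>t\<in>{t \<in> tuples n. f t = 1}. basis_vec t) s" by simp
qed

lemma to_chain_image: "to_chain ` chn isH M (Suc n) = chains_in n M"
proof (intro equalityI subsetI)
  fix f assume "f \<in> to_chain ` chn isH M (Suc n)"
  then obtain v where v: "v \<in> chn isH M (Suc n)" "f = to_chain v" by auto
  have "t \<in> tuples n \<and> tuple_deg t \<in> M" if "f t \<noteq> 0" for t
  proof -
    have t: "t \<noteq> []" "set t \<subseteq> A1_basis" "H (list_of t) \<in> keys v"
      using that v(2) by (auto simp: to_chain_def in_keys_iff split: if_splits)
    with v(1) have "good (H (list_of t))" "length (list_of t) = Suc n" "list_deg (list_of t) \<in> M"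
      by (auto simp: chn_def)
    then show ?thesis
      using tuple_of_in_tuples tuple_deg_tuple_of tuple_of_list_of [OF t(1,2)] by metis
  qed
  then show "f \<in> chains_in n M" by (auto simp: chains_in_def chains_def)
next
  fix f assume f: "f \<in> chains_in n M"
  let ?T = "{t \<in> tuples n. f t = 1}"
  define v where "v = (\<Sum>t\<in>?T. bas (H (list_of t)))"
  have T: "good (H (list_of t))" "tuple_of (list_of t) = t" "length t = Suc n" "tuple_deg t \<in> M" if "t \<in> ?T" for t
    using that f good_list_of [of t n] tuple_of_list_of [of t]
    by (auto simp: tuples_def chains_in_def simp del: good.simps intro!: tuple_of_list_of)
  have "to_chain v = (\<Sum>t\<in>?T. basis_vec t)"
    unfolding v_def to_chain_sum using T by (intro sum.cong) (auto simp: to_chain_bas simp del: good.simps)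
  also have "\<dots> = f" using chain_eq_sum [of f n] f by (simp add: chains_in_def)
  finally have "f = to_chain v" ..
  moreover have "v \<in> chn isH M (Suc n)"
  proof -
    have "keys v \<subseteq> (\<Union>t\<in>?T. keys (bas (H (list_of t))))" unfolding v_def by (rule keys_sum)
    also have "\<dots> \<subseteq> {c. good c \<and> isH c \<and> hdeg c = Suc n \<and> ideg c \<in> M}"
    proof (intro UN_least)
      fix t assume t: "t \<in> ?T"
      have "list_deg (list_of t) = tuple_deg t"
        using tuple_deg_tuple_of [OF T(1)] T(2) t by metis
      then show "keys (bas (H (list_of t))) \<subseteq> {c. good c \<and> isH c \<and> hdeg c = Suc n \<and> ideg c \<in> M}"
        using T [OF t] by (auto simp: bas_def simp del: good.simps)
    qed
    finally show ?thesis by (auto simp: chn_def)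
  qed
  ultimately show "f \<in> to_chain ` chn isH M (Suc n)" by blast
qed

lemma rmult_snoc: "rmult (l @ [a]) c = l @ [a * c]"
  by (induction l) (auto simp: rmult_Cons)

lemma dl_conv_nth:
  "dl l = map (\<lambda>i. take i l @ (l ! i * l ! Suc i) # drop (Suc (Suc i)) l) [0..<length l - 1]"
proof (induction l rule: dl.induct)
  case (1 a b l)
  have "[0..<length (a # b # l) - 1] = 0 # map Suc [0..<length (b # l) - 1]"
    by (simp add: upt_conv_Cons map_Suc_upt del: upt_Suc)
  then show ?case using 1 by (simp add: comp_def)
qed auto

lemma opt_vec_mult:
  assumes "m \<noteq> Nul" "m' \<noteq> Nul"
    and "\<And>c. c \<noteq> Nul \<Longrightarrow> good (H (g c)) \<and> tuple_of (g c) = f (mon_word c)" "\<not> good (H (g Nul))"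
  shows "opt_vec (map_option f (mult (mon_word m) (mon_word m'))) = to_chain (bas (H (g (m * m'))))"
  using assms by (auto simp: mult_mon_word opt_vec_def to_chain_bas zero_fun_def simp del: good.simps)

text \<open>With \<open>a0\<close> stored last, face 0 is \<open>wrap\<close>, the following faces
  are the terms of \<open>dl\<close> in order, and the last face is the final term of
  \<open>dl\<close>. Signs disappear in \<open>bit\<close>.\<close>

lemma hb_basis_eq:
  assumes "good (H k)" "length k = Suc (Suc n)"
  shows "hb_basis (Suc n) (tuple_of k) = to_chain (lsum (D (H k)))"
proof -
  from assms obtain as a where k: "k = as @ [a]" by (cases k rule: rev_cases) auto
  with assms have as: "length as = Suc n" "Nul \<notin> set as" "a \<noteq> Nul" by auto
  let ?t = "map mon_word (a # as)"
  define m where "m i = take i k @ (k ! i * k ! Suc i) # drop (Suc (Suc i)) k" for i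
  have asi: "as ! i \<noteq> Nul" if "i < Suc n" for i using as that by (metis nth_mem)
  have face0: "face 0 ?t = to_chain (bas (H (wrap k)))"
  proof -
    obtain b bs where b: "as = b # bs" using as(1) by (cases as) auto
    have wr: "wrap k = bs @ [a * b]"
      unfolding k b wrap_def using rmult_snoc by simp
    show ?thesis
      unfolding face_def wr using as b
      by (simp, intro opt_vec_mult [where g = "\<lambda>c. bs @ [c]"]) auto
  qed
  have faceS: "face (Suc i) ?t = to_chain (bas (H (m i)))" if "i < n" for i
  proof -
    have mi: "m i = (take i as @ (as ! i * as ! Suc i) # drop (Suc (Suc i)) as) @ [a]"
      using that as by (simp add: m_def k nth_append)
    have "face (Suc i) ?t = opt_vec (map_option
        (\<lambda>c. mon_word a # map mon_word (take i as) @ c # map mon_word (drop (Suc (Suc i)) as))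
        (mult (mon_word (as ! i)) (mon_word (as ! Suc i))))"
      unfolding face_def using as that by (simp add: take_map drop_map)
    also have "\<dots> = to_chain (bas (H (m i)))"
      unfolding mi using as that asi [of i] asi [of "Suc i"]
      by (intro opt_vec_mult [where g = "\<lambda>c. (take i as @ c # drop (Suc (Suc i)) as) @ [a]"])
         (auto simp del: append_assoc dest: in_set_takeD in_set_dropD)
    finally show ?thesis .
  qed
  have last: "last_face (Suc n) ?t = to_chain (bas (H (m n)))"
  proof -
    have mi: "m n = take n as @ [as ! n * a]"
      using as by (simp add: m_def k nth_append)
    have "last_face (Suc n) ?t = opt_vec (map_option (\<lambda>c. c # map mon_word (take n as))
        (mult (mon_word (as ! n)) (mon_word a)))"
      unfolding last_face_def using as by (simp add: take_map)
    also have "\<dots> = to_chain (bas (H (m n)))"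
      unfolding mi using as asi [of n]
      by (intro opt_vec_mult [where g = "\<lambda>c. take n as @ [c]"]) (auto dest: in_set_takeD)
    finally show ?thesis .
  qed
  have bit_sign: "(-1 :: bit) ^ i = 1" for i by simp
  have "hb_basis (Suc n) ?t s = to_chain (lsum (D (H k))) s" for s
  proof -
    have "to_chain (lsum (D (H k))) = to_chain (\<Sum>i<Suc n. bas (H (m i))) + to_chain (bas (H (wrap k)))"
      using assms(2)
      by (simp add: lsum_D_H to_chain_add dl_conv_nth m_def [symmetric] comp_def
          interv_sum_list_conv_sum_set_nat atLeast0LessThan del: upt_Suc sum.lessThan_Suc)
    also have "\<dots> = (\<Sum>i<n. face (Suc i) ?t) + last_face (Suc n) ?t + face 0 ?t"
      using faceS last face0 by (simp add: to_chain_sum to_chain_add)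
    finally have "to_chain (lsum (D (H k))) s = (\<Sum>i<n. face (Suc i) ?t s) + last_face (Suc n) ?t s + face 0 ?t s"
      by (simp add: sum_apply)
    moreover have "hb_basis (Suc n) ?t s = (face 0 ?t s + (\<Sum>i<n. face (Suc i) ?t s)) + last_face (Suc n) ?t s"
      unfolding hb_basis_def bit_sign by (simp only: sum.lessThan_Suc_shift mult_1_left)
    ultimately show ?thesis by (simp only: ac_simps)
  qed
  then show ?thesis by (simp add: k fun_eq_iff)
qed

lemma hoch_b_add: "hoch_b n (f + g) = hoch_b n f + hoch_b n g"
  unfolding hoch_b_def plus_fun_def by (intro ext) (simp only: distrib_right sum.distrib)

lemma hoch_b_0: "hoch_b n 0 = 0"
  by (auto simp: hoch_b_def)

lemma hoch_b_sum: "hoch_b n (sum f A) = (\<Sum>x\<in>A. hoch_b n (f x))"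
  by (induction A rule: infinite_finite_induct) (simp_all only: sum.infinite sum.empty sum.insert hoch_b_add hoch_b_0 simp_thms)

lemma hoch_b_basis_vec:
  assumes "t \<in> tuples n"
  shows "hoch_b n (basis_vec t) = hb_basis n t"
proof
  fix s
  have "hoch_b n (basis_vec t) s = (\<Sum>t'\<in>tuples n. if t' = t then hb_basis n t' s else 0)"
    unfolding hoch_b_def basis_vec_def by (intro sum.cong) auto
  then show "hoch_b n (basis_vec t) s = hb_basis n t s"
    using assms finite_tuples by simp
qed

lemma hoch_b_to_chain:
  assumes "v \<in> chn isH M (Suc (Suc n))"
  shows "hoch_b (Suc n) (to_chain v) = to_chain (lin D v)"
proof -
  have cell: "hoch_b (Suc n) (to_chain (bas c)) = to_chain (lsum (D c))" if "c \<in> keys v" for c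
  proof -
    from that assms obtain k where c: "c = H k" "good (H k)" "length k = Suc (Suc n)"
      by (cases c) (auto simp: chn_def)
    then show ?thesis
      using hb_basis_eq [of k n] hoch_b_basis_vec [OF tuple_of_in_tuples [of k "Suc n"]]
      by (simp add: to_chain_bas del: good.simps)
  qed
  have "hoch_b (Suc n) (to_chain v) = hoch_b (Suc n) (to_chain (\<Sum>c\<in>keys v. bas c))"
    using goodvec_decomp [OF goodvec_chn [OF assms]] by simp
  also have "\<dots> = (\<Sum>c\<in>keys v. to_chain (lsum (D c)))"
    unfolding to_chain_sum hoch_b_sum using cell by (rule sum.cong [OF refl])
  also have "\<dots> = to_chain (lin D v)" by (simp add: lin_def to_chain_sum)
  finally show ?thesis .
qed

definition cycles_in :: "nat \<Rightarrow> nat set \<Rightarrow> chain set" where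
  "cycles_in n M = (if n = 0 then chains_in 0 M else {f \<in> chains_in n M. hoch_b n f = 0})"

definition boundaries_in :: "nat \<Rightarrow> nat set \<Rightarrow> chain set" where
  "boundaries_in n M = hoch_b (Suc n) ` chains_in (Suc n) M"

lemma isH_D: "isH c \<Longrightarrow> d \<in> set (D c) \<Longrightarrow> isH d"
  by (cases c) (auto simp: D.simps split: if_splits)

lemma lin_D_chn_H: "v \<in> chn isH M (Suc n) \<Longrightarrow> lin D v \<in> chn isH M n"
  by (erule chn_linI) (auto dest: D_hdeg D_ideg isH_D)

lemma cycles_in_eq: "cycles_in n M = to_chain ` cyc D isH M (Suc n)"
proof (cases n)
  case 0
  \<comment> \<open>A nonzero boundary would involve a good Hochschild cell of \<open>hdeg\<close>
    0, that is an empty list, which is never good.\<close>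
  have "lin D v = 0" if "v \<in> chn isH M (Suc 0)" for v
  proof -
    have "c \<notin> keys (lin D v)" for c
      using lin_D_chn_H [OF that] by (cases c) (auto simp: chn_def)
    then show ?thesis by (metis all_not_in_conv keys_eq_empty)
  qed
  then have "cyc D isH M (Suc 0) = chn isH M (Suc 0)" by (auto simp: cyc_def)
  then show ?thesis using 0 to_chain_image [of M 0] by (simp add: cycles_in_def)
next
  case (Suc k)
  have "to_chain (lin D v) = 0 \<longleftrightarrow> lin D v = 0" if "v \<in> chn isH M (Suc n)" for v
  proof
    assume "to_chain (lin D v) = 0"
    then have "to_chain (lin D v) = to_chain 0" by simp
    then show "lin D v = 0"
      using inj_onD [OF to_chain_inj, of "lin D v" 0] lin_D_chn_H [OF that] by simp
  qed simp
  then have "hoch_b n (to_chain v) = 0 \<longleftrightarrow> lin D v = 0" if "v \<in> chn isH M (Suc n)" for v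
    using hoch_b_to_chain [of v M k] that Suc by simp
  then show ?thesis
    using Suc unfolding cycles_in_def to_chain_image [symmetric] cyc_def by auto
qed

lemma boundaries_in_eq: "boundaries_in n M = to_chain ` bdr D isH M (Suc n)"
  unfolding boundaries_in_def bdr_def to_chain_image [symmetric] image_image
  by (intro image_cong refl hoch_b_to_chain)

lemma card_cycles_in: "card (cycles_in n M) =
  2 ^ card {c. isW c \<and> hdeg c = Suc n \<and> ideg c \<in> M} * card (boundaries_in n M)"
proof -
  have "bdr D isH M (Suc n) \<subseteq> chn isH M (Suc n)"
    unfolding bdr_def using lin_D_chn_H by blast
  then have "card (cycles_in n M) = card (cyc D isH M (Suc n))"
      "card (boundaries_in n M) = card (bdr D isH M (Suc n))"
    unfolding cycles_in_eq boundaries_in_eq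
    by (intro card_image inj_on_subset [OF to_chain_inj [of M "Suc n"]]; auto simp: cyc_def)+
  moreover have "card (cyc D isH M (Suc n)) * card (bdr D isK M (Suc n)) =
    (2 ^ card {c. isW c \<and> hdeg c = Suc n \<and> ideg c \<in> M} * card (bdr D isH M (Suc n))) *
      card (bdr D isK M (Suc n))"
    by (simp add: card_homology_H_K card_homology_K)
  ultimately show ?thesis
    using card_bdr_pos [of D isK M "Suc n"] by simp
qed

section \<open>From cardinalities to dimensions\<close>

interpretation chain_space: vector_space chscale
  by unfold_locales
    (intro ext, simp only: chscale_def plus_fun_apply distrib_left distrib_right mult.assoc mult_1_left)+

lemma chscale_simps [simp]: "chscale 1 f = f" "chscale 0 f = 0"
  by (auto simp: chscale_def)

lemma subspaceI_add:
  assumes "0 \<in> S" "\<And>f g. f \<in> S \<Longrightarrow> g \<in> S \<Longrightarrow> f + g \<in> S"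
  shows "chain_space.subspace S"
  unfolding chain_space.subspace_def
proof (intro conjI ballI allI)
  fix c f assume "f \<in> S"
  then show "chscale c f \<in> S" using assms(1) by (cases c) auto
qed (use assms in auto)

text \<open>Over the two-element field the linear combinations of a basis are its subset
  sums.\<close>

lemma card_subspace:
  assumes fin: "finite S" and sub: "chain_space.subspace S"
  shows "card S = 2 ^ chain_space.dim S"
proof -
  obtain B where B: "B \<subseteq> S" "chain_space.independent B" "S \<subseteq> chain_space.span B" "card B = chain_space.dim S"
    using chain_space.basis_exists by metis
  have finB: "finite B" using B(1) fin by (rule finite_subset)
  have "bij_betw (\<lambda>A. \<Sum>A) (Pow B) S"
    unfolding bij_betw_def
  proof
    show "inj_on (\<lambda>A. \<Sum>A) (Pow B)"
    proof (rule inj_onI)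
      fix A A' assume A: "A \<in> Pow B" "A' \<in> Pow B" "\<Sum>A = \<Sum>A'"
      define u where "u b = (if b \<in> A then 1 else 0) + (if b \<in> A' then 1 else 0 :: bit)" for b
      have *: "(\<Sum>b\<in>B. chscale (if b \<in> C then 1 else 0) b) = \<Sum>C" if "C \<subseteq> B" for C
      proof -
        have "(\<Sum>b\<in>B. chscale (if b \<in> C then 1 else 0) b) = (\<Sum>b\<in>B. if b \<in> C then b else 0)"
          by (intro sum.cong) auto
        also have "\<dots> = \<Sum>(B \<inter> C)" using finB by (simp add: sum.inter_restrict)
        finally show ?thesis using that by (simp add: Int_absorb1)
      qed
      have "(\<Sum>b\<in>B. chscale (u b) b) = \<Sum>A + \<Sum>A'"
        unfolding u_def chain_space.scale_left_distrib sum.distrib using A * by (simp only: Pow_iff)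
      also have "\<dots> = 0" using A(3) by (auto simp: fun_eq_iff)
      finally have "\<forall>b\<in>B. u b = 0"
        using B(2) finB chain_space.independentD [of B B u] by blast
      then have "b \<in> A \<longleftrightarrow> b \<in> A'" if "b \<in> B" for b
        using that by (auto simp: u_def split: if_splits)
      then show "A = A'" using A by blast
    qed
    show "(\<lambda>A. \<Sum>A) ` Pow B = S"
    proof (intro equalityI subsetI)
      fix f assume "f \<in> (\<lambda>A. \<Sum>A) ` Pow B"
      then obtain A where "A \<subseteq> B" "f = \<Sum>A" by auto
      then show "f \<in> S" using B(1) sub by (auto intro!: chain_space.subspace_sum)
    next
      fix f assume "f \<in> S"
      then have "f \<in> chain_space.span B" using B(3) by blast
      then obtain u where u: "f = (\<Sum>b\<in>B. chscale (u b) b)"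
        unfolding chain_space.span_finite [OF finB] by auto
      have "f = (\<Sum>b\<in>B. if b \<in> {b. u b = 1} then b else 0)"
        unfolding u by (intro sum.cong) auto
      also have "\<dots> = \<Sum>(B \<inter> {b. u b = 1})" using finB by (simp only: sum.inter_restrict)
      finally show "f \<in> (\<lambda>A. \<Sum>A) ` Pow B" by blast
    qed
  qed
  then have "card S = card (Pow B)" by (metis bij_betw_same_card)
  then show ?thesis using finB B(4) by (simp add: card_Pow)
qed

lemma dim_homology: "chain_space.dim (cycles_in n M) =
  card {c. isW c \<and> hdeg c = Suc n \<and> ideg c \<in> M} + chain_space.dim (boundaries_in n M)"
proof -
  have sub: "chain_space.subspace (to_chain ` G)"
    if "0 \<in> G" "\<And>x y. x \<in> G \<Longrightarrow> y \<in> G \<Longrightarrow> x + y \<in> G" for G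
    using that by (intro subspaceI_add) (auto simp: image_iff to_chain_add [symmetric] intro: bexI [of _ 0])
  have "card (cycles_in n M) = 2 ^ chain_space.dim (cycles_in n M)"
       "card (boundaries_in n M) = 2 ^ chain_space.dim (boundaries_in n M)"
    unfolding cycles_in_eq boundaries_in_eq
    by (intro card_subspace sub finite_imageI finite_cyc finite_bdr cyc_subgroup bdr_subgroup; assumption)+
  then have "(2 :: nat) ^ chain_space.dim (cycles_in n M) =
      2 ^ (card {c. isW c \<and> hdeg c = Suc n \<and> ideg c \<in> M} + chain_space.dim (boundaries_in n M))"
    using card_cycles_in [of n M] by (simp add: power_add)
  then show ?thesis by simp
qed

lemma HH_dim_eq: "HH_dim n = card {c. isW c \<and> hdeg c = Suc n}"
proof -
  have "cycles_all n = cycles_in n UNIV" "boundaries_all n = boundaries_in n UNIV"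
    by (auto simp: cycles_all_def cycles_in_def boundaries_all_def boundaries_in_def chains_in_def zero_fun_def)
  then show ?thesis using dim_homology [of n UNIV] by (simp add: HH_dim_def)
qed

lemma HH_bidim_eq: "HH_bidim n m = card {c. isW c \<and> hdeg c = Suc n \<and> ideg c = m}"
proof -
  have "chains_in k {m} = chains_deg k m" for k
    by (auto simp: chains_in_def chains_deg_def)
  then have "cycles n m = cycles_in n {m}" "boundaries n m = boundaries_in n {m}"
    by (auto simp: cycles_def cycles_in_def boundaries_def boundaries_in_def zero_fun_def)
  then show ?thesis using dim_homology [of n "{m}"] by (simp add: HH_bidim_def)
qed

section \<open>Poincare series\<close>

unbundle fps_syntax

definition rgens :: "nat \<Rightarrow> rgen set" where
  "rgens n = {x. rgen_hdeg x = n}"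

fun rgen_shift :: "rgen \<Rightarrow> rgen" where
  "rgen_shift (X i j) = X i (Suc j)"
| "rgen_shift (Y1 j) = Y1 (Suc j)"
| "rgen_shift (Y2 j) = Y2 (Suc j)"
| "rgen_shift (Z i j) = Z i (Suc j)"

lemma rgens_base:
  "rgens 0 = {X 0 0}" "rgens (Suc 0) = {X 1 0, Y1 0}" "rgens 2 = {X 2 0, Y2 0}" "rgens 3 = {X 3 0, Z 0 0}"
proof -
  have "x \<in> rgens 0 \<longleftrightarrow> x \<in> {X 0 0}" "x \<in> rgens (Suc 0) \<longleftrightarrow> x \<in> {X 1 0, Y1 0}"
    "x \<in> rgens 2 \<longleftrightarrow> x \<in> {X 2 0, Y2 0}" "x \<in> rgens 3 \<longleftrightarrow> x \<in> {X 3 0, Z 0 0}" for x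
    unfolding rgens_def by (cases x; auto; presburger)+
  then show "rgens 0 = {X 0 0}" "rgens (Suc 0) = {X 1 0, Y1 0}" "rgens 2 = {X 2 0, Y2 0}"
    "rgens 3 = {X 3 0, Z 0 0}" by blast+
qed

text \<open>The periodicity shift reaches all generators except those with \<open>j = 0\<close>;
  among these \<open>Y1\<close> and \<open>Y2\<close> occur only in degrees 1 and 2, which leaves
  one \<open>X\<close> and one \<open>Z\<close>.\<close>

lemma rgens_step: "rgens (n + 4) = insert (X (n + 4) 0) (insert (Z (n + 1) 0) (rgen_shift ` rgens n))"
proof (intro equalityI subsetI)
  fix x assume x: "x \<in> rgens (n + 4)"
  show "x \<in> insert (X (n + 4) 0) (insert (Z (n + 1) 0) (rgen_shift ` rgens n))"
  proof (cases x)
    case (X i j)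
    then show ?thesis using x
      by (cases j) (auto simp: rgens_def intro!: image_eqI [of _ _ "X i (j - 1)"])
  next
    case (Y1 j)
    then show ?thesis using x
      by (cases j) (auto simp: rgens_def intro!: image_eqI [of _ _ "Y1 (j - 1)"])
  next
    case (Y2 j)
    then show ?thesis using x
      by (cases j) (auto simp: rgens_def intro!: image_eqI [of _ _ "Y2 (j - 1)"])
  next
    case (Z i j)
    then show ?thesis using x
      by (cases j) (auto simp: rgens_def intro!: image_eqI [of _ _ "Z i (j - 1)"])
  qed
next
  fix x assume "x \<in> insert (X (n + 4) 0) (insert (Z (n + 1) 0) (rgen_shift ` rgens n))"
  then show "x \<in> rgens (n + 4)"
  proof (elim insertE imageE)
    fix y assume "x = rgen_shift y" "y \<in> rgens n"
    then show "x \<in> rgens (n + 4)" by (cases y) (auto simp: rgens_def)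
  qed (auto simp: rgens_def)
qed

lemma inj_rgen_shift: "inj_on rgen_shift A"
  by (rule inj_onI) (auto elim!: rgen_shift.elims)

lemma finite_rgens: "finite (rgens n)"
  by (rule finite_subset [OF _ finite_rgen_hdeg [of n]]) (auto simp: rgens_def)

lemma sum_rgens_step:
  fixes f :: "rgen \<Rightarrow> 'a :: comm_monoid_add"
  shows "(\<Sum>x\<in>rgens (n + 4). f x) =
    f (X (n + 4) 0) + (f (Z (n + 1) 0) + (\<Sum>x\<in>rgens n. f (rgen_shift x)))"
proof -
  have "X (n + 4) 0 \<notin> insert (Z (n + 1) 0) (rgen_shift ` rgens n)" "Z (n + 1) 0 \<notin> rgen_shift ` rgens n"
    by (auto elim!: rgen_shift.elims dest: sym)
  then show ?thesis
    unfolding rgens_step using finite_rgens [of n] by (simp add: sum.reindex [OF inj_rgen_shift])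
qed

lemma crit_shift [simp]: "crit (rgen_shift x) = crit x"
  by (cases x) auto

lemma rgen_ideg_shift [simp]: "rgen_ideg (rgen_shift x) = rgen_ideg x + 12"
  by (cases x) auto

lemma crit_cells: "{c. isW c \<and> hdeg c = Suc n} = (\<lambda>(x, w). L x [w]) ` (SIGMA x:rgens n. set (crit x))"
  (is "?A = ?B")
proof (intro equalityI subsetI)
  fix c assume "c \<in> ?A"
  then show "c \<in> ?B" using isW_imp [of c] by (auto simp: rgens_def image_iff)
qed (auto simp: rgens_def)

lemma sum_crit_cells:
  fixes f :: "cell \<Rightarrow> 'a :: comm_monoid_add"
  shows "(\<Sum>c | isW c \<and> hdeg c = Suc n. f c) = (\<Sum>x\<in>rgens n. \<Sum>w\<in>set (crit x). f (L x [w]))"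
proof -
  have "inj_on (\<lambda>(x, w). L x [w]) (SIGMA x:rgens n. set (crit x))"
    by (auto simp: inj_on_def)
  then show ?thesis
    unfolding crit_cells by (simp add: sum.reindex sum.Sigma finite_rgens split_def)
qed

lemma HH_dim_sum: "HH_dim n = (\<Sum>x\<in>rgens n. card (set (crit x)))"
  using sum_crit_cells [of "\<lambda>_. 1 :: nat" n] by (simp add: HH_dim_eq)

lemma HH_dim_base: "HH_dim 0 = 5" "HH_dim (Suc 0) = 8" "HH_dim 2 = 9" "HH_dim 3 = 10"
  by (simp_all add: HH_dim_sum rgens_base)

lemma HH_dim_step: "HH_dim (n + 4) = HH_dim n + 8"
  unfolding HH_dim_sum sum_rgens_step by simp

lemma nat_cases_4:
  obtains "n = 0" | "n = Suc 0" | "n = 2" | "n = 3" | k where "n = k + (4 :: nat)"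
proof -
  have "n < 4 \<or> (\<exists>k. n = k + 4)" by presburger
  then show ?thesis using that by (metis One_nat_def less_Suc_eq numeral_2_eq_2 numeral_3_eq_3 numeral_eq_Suc
      less_one pred_numeral_simps(2) semiring_norm(26) semiring_norm(27))
qed

lemma HH_dim_formula:
  "HH_dim n = (if even n then 2 * n + 5 else if n mod 4 = 1 then 2 * n + 6 else 2 * n + 4)"
proof (induction n rule: less_induct)
  case (less n)
  show ?case
  proof (cases n rule: nat_cases_4)
    case (5 k)
    then show ?thesis using less [of k] by (simp add: HH_dim_step del: One_nat_def)
  qed (simp_all add: HH_dim_base)
qed

definition HH_row :: "nat \<Rightarrow> rat fps" where
  "HH_row n = (\<Sum>x\<in>rgens n. \<Sum>w\<in>set (crit x). fps_X ^ (rgen_ideg x + mon_deg w))"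

lemma HH_bipoincare_nth: "HH_bipoincare $ n = HH_row n"
proof (rule fps_ext)
  fix m
  let ?W = "{c. isW c \<and> hdeg c = Suc n}"
  have fin: "finite ?W" by (rule finite_subset [OF _ finite_cells [of "Suc n"]]) auto
  have "HH_row n = (\<Sum>c\<in>?W. fps_X ^ ideg c)"
    unfolding sum_crit_cells HH_row_def by simp
  then have "HH_row n $ m = (\<Sum>c\<in>?W. if m = ideg c then 1 else 0)"
    by (simp add: fps_sum_nth)
  also have "\<dots> = of_nat (card (?W \<inter> {c. m = ideg c}))"
    using fin by (simp add: sum.If_cases)
  also have "?W \<inter> {c. m = ideg c} = {c. isW c \<and> hdeg c = Suc n \<and> ideg c = m}"
    by auto
  finally show "HH_bipoincare $ n $ m = HH_row n $ m"
    by (simp add: HH_bipoincare_def HH_bidim_eq)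
qed

lemma HH_row_base:
  "HH_row 0 = 1 + fps_X + fps_X ^ 2 + fps_X ^ 3 + fps_X ^ 6"
  "HH_row (Suc 0) = fps_X + 2 * fps_X ^ 2 + fps_X ^ 3 + fps_X ^ 4 + fps_X ^ 6 + fps_X ^ 7 + fps_X ^ 8"
  "HH_row 2 = fps_X ^ 2 + fps_X ^ 3 + fps_X ^ 4 + 2 * fps_X ^ 7 + 2 * fps_X ^ 8 + fps_X ^ 9 + fps_X ^ 10"
  "HH_row 3 = fps_X ^ 3 + fps_X ^ 4 + fps_X ^ 7 + 2 * fps_X ^ 8 + 2 * fps_X ^ 9 + fps_X ^ 10 +
     fps_X ^ 12 + fps_X ^ 13"
  unfolding HH_row_def rgens_base by (simp_all add: algebra_simps eval_nat_numeral)

text \<open>The new generators have internal degrees \<open>n + 4\<close> and \<open>n + 8\<close>,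
  each with critical monomials of degrees 0, 1, 5, 6. This gives
  \<open>(1 + u) (1 + u^5) (1 + u^4)\<close>; the last two factors are multiplied out.\<close>

lemma HH_row_step:
  "HH_row (n + 4) = fps_X ^ 12 * HH_row n +
     fps_X ^ (n + 4) * ((1 + fps_X) * (1 + fps_X ^ 4 + fps_X ^ 5 + fps_X ^ 9))"
proof -
  have "(\<Sum>x\<in>rgens n. \<Sum>w\<in>set (crit (rgen_shift x)). fps_X ^ (rgen_ideg (rgen_shift x) + mon_deg w))
     = fps_X ^ 12 * HH_row n"
    by (simp add: HH_row_def sum_distrib_left power_add mult_ac)
  then show ?thesis
    unfolding HH_row_def [of "n + 4"] sum_rgens_step
    by (simp add: power_add algebra_simps eval_nat_numeral)
qed

text \<open>The coefficients \<open>rat fps\<close> form no field, but the constant coefficient 1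
  makes \<open>inverse\<close> the right inverse series.\<close>

lemma fps_mult_inverse_unit:
  fixes f :: "rat fps fps"
  assumes "f $ 0 = 1"
  shows "f * inverse f = 1"
proof -
  have "f * fps_right_inverse f 1 = 1"
    by (rule fps_right_inverse) (simp add: assms)
  moreover have "inverse f = fps_right_inverse f (inverse (f $ 0))"
    by (rule fps_inverse_def)
  ultimately show ?thesis by (simp add: assms)
qed

lemma fps_inverse_unit_unique:
  fixes f :: "rat fps fps"
  assumes "f $ 0 = 1" "f * g = 1"
  shows "inverse f = g"
proof -
  have "inverse f = inverse f * (f * g)" by (simp add: assms(2))
  also have "\<dots> = (f * inverse f) * g" by (simp only: mult_ac)
  also have "\<dots> = g" by (simp add: fps_mult_inverse_unit [OF assms(1)])
  finally show ?thesis .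
qed

lemma HH_poincare_eq:
  "HH_poincare = (5 + 8 * fps_X + 9 * fps_X ^ 2 + 10 * fps_X ^ 3 + 8 * fps_X ^ 4 * inverse (1 - fps_X))
     * inverse (1 - fps_X ^ 4)" (is "_ = ?R * _")
proof -
  have geom: "inverse (1 - fps_X) = (Abs_fps (\<lambda>_. 1) :: rat fps)"
    by (metis fps_inverse_gp' fps_inverse_idempotent fps_nth_Abs_fps zero_neq_one)
  \<comment> \<open>The coefficients on the left are the differences of \<open>HH_dim\<close> at
    distance 4: the base values for \<open>n < 4\<close>, and 8 from then on.\<close>
  have "(HH_poincare * (1 - fps_X ^ 4)) $ n = ?R $ n" for n
  proof -
    have num: "(numeral k * g) $ n = numeral k * g $ n" for k and g :: "rat fps"
      by (simp add: numeral_fps_const)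
    have lhs: "(HH_poincare * (1 - fps_X ^ 4)) $ n =
        of_nat (HH_dim n) - (if n < 4 then 0 else of_nat (HH_dim (n - 4)))"
      by (simp add: HH_poincare_def algebra_simps fps_X_power_mult_right_nth)
    have rhs: "?R $ n = (if n = 0 then 5 else 0) + 8 * (if n = 1 then 1 else 0) + 9 * (if n = 2 then 1 else 0)
        + 10 * (if n = 3 then 1 else 0) + 8 * (if n < 4 then 0 else 1)"
      unfolding geom by (simp add: num mult.assoc fps_X_power_mult_nth fps_numeral_nth)
    show ?thesis
      unfolding lhs rhs
      by (cases n rule: nat_cases_4) (simp_all add: HH_dim_base HH_dim_step)
  qed
  then have "HH_poincare * (1 - fps_X ^ 4) = ?R" by (rule fps_ext)
  moreover have "(1 - fps_X ^ 4) * inverse (1 - fps_X ^ 4) = (1 :: rat fps)"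
    by (rule inverse_mult_eq_1') simp
  ultimately show ?thesis by (metis mult.assoc mult.right_neutral)
qed

lemma HH_bipoincare_eq:
  fixes S U :: "rat fps fps"
  defines "S \<equiv> fps_X" and "U \<equiv> fps_const fps_X"
  shows "HH_bipoincare =
        ((1 + U) * (1 + U ^ 2 + S * U * (1 + U ^ 2 + U ^ 5)
                   + S ^ 2 * U ^ 2 * (1 + 2 * U ^ 5 + U ^ 7)
                   + S ^ 3 * U ^ 3 * (1 + U ^ 4 + U ^ 5 + U ^ 6 + U ^ 9)
                   + S ^ 4 * U ^ 4 * (1 + U ^ 4 + U ^ 5 + U ^ 9) * inverse (1 - S * U))
         + U ^ 6 + S * U ^ 2 + S * U ^ 8 + S ^ 2 * U ^ 4)
        * inverse (1 - S ^ 4 * U ^ 12)" (is "_ = ?R * inverse ?E")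
proof -
  define G where "G = (Abs_fps (\<lambda>n. fps_X ^ n) :: rat fps fps)"
  have U_pow: "U ^ k = fps_const (fps_X ^ k)" for k
    by (simp add: U_def fps_const_power)
  have "(1 - S * U) * G = 1"
  proof (rule fps_ext)
    fix n
    have "((1 - S * U) * G) $ n = G $ n - (fps_X * (fps_const fps_X * G)) $ n"
      by (simp add: S_def U_def left_diff_distrib mult.assoc)
    also have "\<dots> = 1 $ n"
      by (cases n) (simp_all add: G_def)
    finally show "((1 - S * U) * G) $ n = 1 $ n" .
  qed
  then have geom: "inverse (1 - S * U) = G"
    by (intro fps_inverse_unit_unique) (simp_all add: S_def)
  have const: "fps_const (HH_row 0) = 1 + U + U ^ 2 + U ^ 3 + U ^ 6"
    "fps_const (HH_row (Suc 0)) = U + 2 * U ^ 2 + U ^ 3 + U ^ 4 + U ^ 6 + U ^ 7 + U ^ 8"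
    "fps_const (HH_row 2) = U ^ 2 + U ^ 3 + U ^ 4 + 2 * U ^ 7 + 2 * U ^ 8 + U ^ 9 + U ^ 10"
    "fps_const (HH_row 3) = U ^ 3 + U ^ 4 + U ^ 7 + 2 * U ^ 8 + 2 * U ^ 9 + U ^ 10 + U ^ 12 + U ^ 13"
    "fps_const (fps_X ^ 4 * ((1 + fps_X) * (1 + fps_X ^ 4 + fps_X ^ 5 + fps_X ^ 9))) =
       U ^ 4 * ((1 + U) * (1 + U ^ 4 + U ^ 5 + U ^ 9))"
    by (simp_all add: HH_row_base U_def fps_const_power [symmetric]
        fps_const_add [symmetric] fps_const_mult [symmetric] fps_numeral_fps_const [symmetric]
        del: fps_const_power fps_const_add fps_const_mult)
  \<comment> \<open>Sorted by powers of \<open>S\<close>, the polynomial part is the rows 0 to 3;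
    from degree 4 on only the geometric tail contributes.\<close>
  have "?R = fps_const (HH_row 0) + S * fps_const (HH_row (Suc 0)) + S ^ 2 * fps_const (HH_row 2) +
      S ^ 3 * fps_const (HH_row 3) +
      S ^ 4 * (fps_const (fps_X ^ 4 * ((1 + fps_X) * (1 + fps_X ^ 4 + fps_X ^ 5 + fps_X ^ 9))) * G)"
    unfolding geom const by algebra
  then have R_nth: "?R $ n = (if n = 0 then HH_row 0 else 0) + (if n = 1 then HH_row (Suc 0) else 0) +
      (if n = 2 then HH_row 2 else 0) + (if n = 3 then HH_row 3 else 0) +
      (if n < 4 then 0 else fps_X ^ 4 * ((1 + fps_X) * (1 + fps_X ^ 4 + fps_X ^ 5 + fps_X ^ 9)) * fps_X ^ (n - 4))" for n
    by (simp add: S_def fps_X_power_mult_nth G_def)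
  have "HH_bipoincare * ?E = ?R"
  proof (rule fps_ext)
    fix n
    have "(HH_bipoincare * ?E) $ n = HH_row n - (if n < 4 then 0 else fps_X ^ 12 * HH_row (n - 4))"
      by (simp add: S_def U_pow right_diff_distrib mult.assoc [symmetric] fps_X_power_mult_right_nth
          HH_bipoincare_nth mult.commute [of _ "fps_X ^ 12"])
    also have "\<dots> = ?R $ n"
      unfolding R_nth
      by (cases n rule: nat_cases_4) (simp_all add: HH_row_step power_add mult_ac)
    finally show "(HH_bipoincare * ?E) $ n = ?R $ n" .
  qed
  then have "?R * inverse ?E = HH_bipoincare * (?E * inverse ?E)"
    by (simp only: mult.assoc [symmetric])
  also have "?E * inverse ?E = 1"
    by (rule fps_mult_inverse_unit) (simp add: S_def)
  finally show ?thesis by simp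
qed

theorem theorem4:
  fixes s :: "rat fps" and S U :: "rat fps fps"
  defines "s \<equiv> fps_X" and "S \<equiv> fps_X" and "U \<equiv> fps_const fps_X"
  shows "(\<forall>n. HH_dim n = (if even n then 2 * n + 5
                           else if n mod 4 = 1 then 2 * n + 6
                           else 2 * n + 4))
    \<and> HH_poincare = (5 + 8 * s + 9 * s ^ 2 + 10 * s ^ 3 + 8 * s ^ 4 * inverse (1 - s))
                      * inverse (1 - s ^ 4)
    \<and> HH_bipoincare =
        ((1 + U) * (1 + U ^ 2 + S * U * (1 + U ^ 2 + U ^ 5)
                   + S ^ 2 * U ^ 2 * (1 + 2 * U ^ 5 + U ^ 7)
                   + S ^ 3 * U ^ 3 * (1 + U ^ 4 + U ^ 5 + U ^ 6 + U ^ 9)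
                   + S ^ 4 * U ^ 4 * (1 + U ^ 4 + U ^ 5 + U ^ 9) * inverse (1 - S * U))
         + U ^ 6 + S * U ^ 2 + S * U ^ 8 + S ^ 2 * U ^ 4)
        * inverse (1 - S ^ 4 * U ^ 12)"
  unfolding s_def S_def U_def
  using HH_dim_formula HH_poincare_eq HH_bipoincare_eq by blast

end
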